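(* Let $\mathscr{A}=(\mathscr{C},\mathscr{O})$ be an algebra inherited from the algebra $\mathfrak{G}$ of finite graphs, and let $\varphi$ be a sentence of the counting monadic second-order language of graphs. Then for every $n\in\mathbb{N}$, the set $\{\,G\in\mathscr{C}_n : \models_{\Omega(G)}\varphi\,\}$ is $\mathscr{A}$-recognisable.
   Context: Graphs. $\mathbb{N}$ contains $0$. A graph is $G=(V,E,\langle\_\rangle)$ with $V$ a finite nonempty set of vertices, $E$ a finite set of edges disjoint from $V$, and $\langle\_\rangle:E\to V^*$ assigning to every edge $e$ a nonempty finite word of vertices (its end points); $|e|$ denotes the length of $\langle e\rangle$. (So graphs are hypergraphs; parallel edges and repeated end points are allowed.) A graph of type $n\in\mathbb{N}$ is a graph together with a (not necessarily injective) map $t:\{1,\dots,n\}\to V$; the $t(i)$ are its terminals. $\mathfrak{G}_n$ is the set of graphs of type $n$; names of vertices and edges are immaterial, i.e. two typed graphs are identified if there are bijections of vertices and edges preserving the words $\langle e\rangle$ and the map $t$. Counting monadic second-order language of graphs. Formulas are built with $\neg,\wedge,\forall$ (other connectives and $\exists$ being abbreviations) from individual variables and set variables (unary predicate variables), with atomic formulas $\mathrm{vert}(x)$, $\mathrm{edge}(x)$, $x=y$, $X(x)$, for each $m\in\mathbb{N}$, $\mathrm{conn}_m(y,x_1,\dots,x_m)$, and, for $p\in\mathbb{N}_{>0}$ and $0\le r\le p$, $\mathbf{Card}^p_r(X)$; quantification is over individual variables and set variables. A sentence is a formula without free variables. In the structure $\Omega(G)$ induced by a graph $G$, individual variables range over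 $V\cup E$, set variables range over all subsets of $V$ and all subsets of $E$, $\mathrm{vert}$ and $\mathrm{edge}$ mean membership in $V$ and $E$, $X(x)$ means $x\in X$, $\mathrm{conn}_m(y,x_1,\dots,x_m)$ holds iff $y\in E$ and $\langle y\rangle=x_1\cdots x_m$, and $\mathbf{Card}^p_r(X)$ holds iff $|X|\equiv r \pmod p$. (Terminals are not visible.) $\models_{\Omega(G)}\varphi$ means $\varphi$ is true in $\Omega(G)$. Algebras. A signature $\mathscr{S}=(\mathscr{T},\mathscr{F},\langle\_\rangle)$ consists of a set $\mathscr T$ of sorts, a set $\mathscr F$ of function symbols and a typing $\langle f\rangle=(t_1\cdots t_r,t)\in\mathscr{T}^*\times\mathscr{T}$ for $f\in\mathscr{F}$ ($r$ is the arity, $t$ the output sort). An $\mathscr{S}$-algebra $\mathscr{A}=(\mathscr{C},\mathscr{O})$ consists of disjoint carrier sets $\mathscr{C}_t$ ($t\in\mathscr{T}$) and operations $\mathscr{O}_f:\mathscr{C}_{t_1}\times\dots\times\mathscr{C}_{t_r}\to\mathscr{C}_t$. An $\mathscr{S}$-algebra morphism is a sort-indexed family of maps of carriers commuting with all operations. An algebra is locally finite if each carrier is finite. For $t\in\mathscr T$, a subset $\mathscr{L}\subseteq\mathscr{C}_t$ is $\mathscr{A}$-recognisable if there are a locally finite $\mathscr{S}$-algebra $\mathscr{B}$ with carriers $\mathscr{D}_u$, an $\mathscr{S}$-algebra morphism $h=(h_u)_u:\mathscr{A}\to\mathscr{B}$ and a subset $\mathscr{M}\subseteq\mathscr{D}_t$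 with $\mathscr{L}=h_t^{-1}(\mathscr{M})$. Inherited algebras. A pre-expression over a signature is a finite nonempty rooted ordered tree with vertices labelled by function symbols such that a vertex labelled $f$ has either no children or exactly as many children as the arity of $f$, in the latter case with the output sorts of the children's labels equal, in order, to the input sorts of $f$. Its input type is the concatenation, over the leaves in traversal order, of the input types of their labels; its output sort is that of the root label. In an algebra it defines, by evaluating from the leaves upward, an operation of this type. The closure $\overline{\mathscr{A}}$ of $\mathscr{A}$ is $\mathscr{A}$ with, for every sort $t$ and every $c\in\mathscr{C}_t$, an additional nullary function symbol of value $c$. The flattening $\mathrm{Fl}(\mathscr{A})$ is $\mathscr{A}$ with, for every pre-expression over its signature, an additional function symbol of the same type whose operation is evaluation of that pre-expression. A subalgebra has the same set of sorts, a subset of the function symbols (with the same typing), subsets of the carriers, and the restricted operations (the carriers being closed under them). $\mathscr{B}$ is inherited from $\mathscr{A}$ if $\mathscr{B}$ is a subalgebra of $\mathrm{Fl}(\overline{\mathscr{A}})$. The algebra $\mathfrak{G}$. Its sorts are the elements of $\mathbb{N}$, its carriers are the $\mathfrak{G}_n$, and its operations are: (i) for all $n,m$, the disjoint sum $\oplus:\mathfrak{G}_n\times\mathfrak{G}_m\to\mathfrak{G}_{n+m}$ (disjoint union, terminals of the first graph followed by those of the second); (ii) for every map $\sigma:\{1,\dots,n\}\to\{1,\dots,m\}$ the terminal redefinition $\mathfrak{G}_m\to\mathfrak{G}_n$, $(G,t)\mapsto(G,t\circ\sigma)$; (iii) for $a,b\in\{1,\dots,n\}$ the fusion $\mathfrak{G}_n\to\mathfrak{G}_n$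 identifying the vertices $t(a)$ and $t(b)$ (all edges kept, words and terminal map transported along the identification; the identity if $t(a)=t(b)$); (iv) the constant $\mathfrak{v}\in\mathfrak{G}_1$ (one vertex, no edges, the vertex is the terminal) and for $n\ge1$ the constant $\mathfrak{e}_n\in\mathfrak{G}_n$ ($n$ distinct vertices $v_1,\dots,v_n$, one edge $e$ with $\langle e\rangle=v_1\cdots v_n$, $t(i)=v_i$). *)

theory Defs
  imports Main
begin

section \<open>Many-sorted algebras and recognisability\<close>

record ('t, 'f) signature =
  sorts :: "'t set"
  syms :: "'f set"
  inT :: "'f \<Rightarrow> 't list"
  outT :: "'f \<Rightarrow> 't"

record ('t, 'f, 'c) algebra =
  sig :: "('t, 'f) signature"
  carr :: "'t \<Rightarrow> 'c set"
  oper :: "'f \<Rightarrow> 'c list \<Rightarrow> 'c"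

definition is_signature :: "('t, 'f) signature \<Rightarrow> bool" where
  "is_signature S \<longleftrightarrow>
     (\<forall>f \<in> syms S. set (inT S f) \<subseteq> sorts S \<and> outT S f \<in> sorts S)"

definition args :: "('t, 'f, 'c) algebra \<Rightarrow> 't list \<Rightarrow> 'c list set" where
  "args A ts = {xs. list_all2 (\<lambda>x t. x \<in> carr A t) xs ts}"

definition is_algebra :: "('t, 'f, 'c) algebra \<Rightarrow> bool" where
  "is_algebra A \<longleftrightarrow>
     is_signature (sig A) \<and>
     (\<forall>s \<in> sorts (sig A). \<forall>t \<in> sorts (sig A). s \<noteq> t \<longrightarrow> carr A s \<inter> carr A t = {}) \<and>
     (\<forall>f \<in> syms (sig A). \<forall>xs \<in> args A (inT (sig A) f). oper A f xs \<in> carr A (outT (sig A) f))"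

definition morphism ::
  "('t, 'f, 'c) algebra \<Rightarrow> ('t, 'f, 'd) algebra \<Rightarrow> ('t \<Rightarrow> 'c \<Rightarrow> 'd) \<Rightarrow> bool" where
  "morphism A B h \<longleftrightarrow>
     sig B = sig A \<and>
     (\<forall>t \<in> sorts (sig A). \<forall>x \<in> carr A t. h t x \<in> carr B t) \<and>
     (\<forall>f \<in> syms (sig A). \<forall>xs \<in> args A (inT (sig A) f).
        h (outT (sig A) f) (oper A f xs) = oper B f (map2 h (inT (sig A) f) xs))"

definition locally_finite :: "('t, 'f, 'c) algebra \<Rightarrow> bool" where
  "locally_finite A \<longleftrightarrow> (\<forall>t \<in> sorts (sig A). finite (carr A t))"

text \<open>The quantifier over \<open>B\<close> has to fix a type for the elements of \<open>B\<close>. Every locally finite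
  algebra with sorts in \<open>'t\<close> is isomorphic to one with elements in \<open>'t \<times> nat\<close>, so nothing is lost;
  see \<open>recognisableI\<close> below.\<close>

definition recognisable :: "('t, 'f, 'c) algebra \<Rightarrow> 't \<Rightarrow> 'c set \<Rightarrow> bool" where
  "recognisable A t L \<longleftrightarrow>
     t \<in> sorts (sig A) \<and> L \<subseteq> carr A t \<and>
     (\<exists>(B :: ('t, 'f, 't \<times> nat) algebra) h M.
        is_algebra B \<and> locally_finite B \<and> morphism A B h \<and>
        M \<subseteq> carr B t \<and> L = {x \<in> carr A t. h t x \<in> M})"

lemma args_iff:
  "xs \<in> args A ts \<longleftrightarrow>
     length xs = length ts \<and> (\<forall>i < length ts. xs ! i \<in> carr A (ts ! i))"
  by (auto simp: args_def list_all2_conv_all_nth)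

lemma recognisableI:
  fixes A :: "('t, 'f, 'c) algebra" and B :: "('t, 'f, 'd) algebra"
  assumes A: "is_algebra A" and t: "t \<in> sorts (sig A)"
    and B: "is_algebra B" "locally_finite B" and h: "morphism A B h"
    and M: "M \<subseteq> carr B t" and L: "L = {x \<in> carr A t. h t x \<in> M}"
  shows "recognisable A t L"
proof -
  have sig: "sig B = sig A" using h by (simp add: morphism_def)
  have "\<exists>e :: 'd \<Rightarrow> nat. inj_on e (carr B s)" if "s \<in> sorts (sig A)" for s
    using finite_imp_inj_to_nat_seg[of "carr B s"] B(2) that sig
    by (auto simp: locally_finite_def)
  then obtain e :: "'t \<Rightarrow> 'd \<Rightarrow> nat"
    where e: "\<And>s. s \<in> sorts (sig A) \<Longrightarrow> inj_on (e s) (carr B s)" by metis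
  define en where "en s x = (s, e s x)" for s x
  define de where "de s = the_inv_into (carr B s) (en s)" for s
  have inj: "inj_on (en s) (carr B s)" if "s \<in> sorts (sig A)" for s
    using e[OF that] by (auto simp: inj_on_def en_def)
  have de: "de s (en s x) = x" if "s \<in> sorts (sig A)" "x \<in> carr B s" for s x
    using inj[OF that(1)] that(2) by (simp add: de_def the_inv_into_f_f)
  define B' :: "('t, 'f, 't \<times> nat) algebra" where
    "B' = \<lparr>sig = sig A, carr = (\<lambda>s. en s ` carr B s),
           oper = (\<lambda>f xs. en (outT (sig A) f) (oper B f (map2 de (inT (sig A) f) xs)))\<rparr>"
  have S: "is_signature (sig A)" using A by (simp add: is_algebra_def)
  have arg: "map2 de ts xs \<in> args B ts" if "xs \<in> args B' ts" "set ts \<subseteq> sorts (sig A)" for ts xs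
  proof -
    have "de (ts ! i) (xs ! i) \<in> carr B (ts ! i)" if "i < length ts" for i
    proof -
      have "ts ! i \<in> sorts (sig A)" using that \<open>set ts \<subseteq> sorts (sig A)\<close> nth_mem by blast
      moreover have "xs ! i \<in> en (ts ! i) ` carr B (ts ! i)"
        using \<open>xs \<in> args B' ts\<close> that by (simp add: args_iff B'_def)
      then obtain y where "y \<in> carr B (ts ! i)" "xs ! i = en (ts ! i) y" by blast
      ultimately show ?thesis by (simp add: de)
    qed
    then show ?thesis using that by (simp add: args_iff)
  qed
  have "is_algebra B'"
    unfolding is_algebra_def
  proof (intro conjI ballI impI)
    show "is_signature (sig B')" using S by (simp add: B'_def)
    show "carr B' s \<inter> carr B' u = {}" if "s \<noteq> u" for s u
      using that by (auto simp: B'_def en_def)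
    fix f xs assume "f \<in> syms (sig B')" "xs \<in> args B' (inT (sig B') f)"
    then have f: "f \<in> syms (sig A)" and xs: "xs \<in> args B' (inT (sig A) f)"
      by (simp_all add: B'_def)
    have "set (inT (sig A) f) \<subseteq> sorts (sig A)" using S f by (simp add: is_signature_def)
    from arg[OF xs this] show "oper B' f xs \<in> carr B' (outT (sig B') f)"
      using B(1) sig f by (auto simp: B'_def is_algebra_def)
  qed
  moreover have "locally_finite B'"
    using B(2) sig by (simp add: locally_finite_def B'_def)
  moreover have "morphism A B' (\<lambda>s x. en s (h s x))"
    unfolding morphism_def
  proof (intro conjI ballI)
    show "sig B' = sig A" by (simp add: B'_def)
    show "en s (h s x) \<in> carr B' s" if "s \<in> sorts (sig A)" "x \<in> carr A s" for s x
      using h that by (auto simp: B'_def morphism_def)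
    fix f xs assume f: "f \<in> syms (sig A)" and xs: "xs \<in> args A (inT (sig A) f)"
    let ?ts = "inT (sig A) f"
    have ts: "set ?ts \<subseteq> sorts (sig A)" using S f by (simp add: is_signature_def)
    have "map2 de ?ts (map2 (\<lambda>s x. en s (h s x)) ?ts xs) = map2 h ?ts xs"
    proof (rule nth_equalityI)
      fix i assume "i < length (map2 de ?ts (map2 (\<lambda>s x. en s (h s x)) ?ts xs))"
      then have i: "i < length ?ts" "i < length xs" by auto
      have s: "?ts ! i \<in> sorts (sig A)" using ts i nth_mem by blast
      have "h (?ts ! i) (xs ! i) \<in> carr B (?ts ! i)"
        using h s xs i by (auto simp: morphism_def args_iff)
      then show "map2 de ?ts (map2 (\<lambda>s x. en s (h s x)) ?ts xs) ! i = map2 h ?ts xs ! i"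
        using i s by (simp add: de)
    qed simp
    then show "en (outT (sig A) f) (h (outT (sig A) f) (oper A f xs)) =
        oper B' f (map2 (\<lambda>s x. en s (h s x)) ?ts xs)"
      using h f xs by (simp add: B'_def morphism_def)
  qed
  moreover have "en t ` M \<subseteq> carr B' t" using M by (auto simp: B'_def)
  moreover have "L = {x \<in> carr A t. en t (h t x) \<in> en t ` M}"
  proof -
    have "en t (h t x) \<in> en t ` M \<longleftrightarrow> h t x \<in> M" if "x \<in> carr A t" for x
      using inj_on_image_mem_iff[OF inj[OF t] _ M] h t that by (simp add: morphism_def)
    then show ?thesis using L by blast
  qed
  ultimately show ?thesis
    unfolding recognisable_def using t L by blast
qed


section \<open>Inherited algebras\<close>

datatype ('t, 'f, 'c) clsym = Base 'f | Const 't 'c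

definition closure_sig :: "('t, 'f, 'c) algebra \<Rightarrow> ('t, ('t, 'f, 'c) clsym) signature" where
  "closure_sig A =
     \<lparr>sorts = sorts (sig A),
      syms = Base ` syms (sig A) \<union> {Const t c | t c. t \<in> sorts (sig A) \<and> c \<in> carr A t},
      inT = (\<lambda>s. case s of Base f \<Rightarrow> inT (sig A) f | Const t c \<Rightarrow> []),
      outT = (\<lambda>s. case s of Base f \<Rightarrow> outT (sig A) f | Const t c \<Rightarrow> t)\<rparr>"

definition closure_alg :: "('t, 'f, 'c) algebra \<Rightarrow> ('t, ('t, 'f, 'c) clsym, 'c) algebra" where
  "closure_alg A =
     \<lparr>sig = closure_sig A,
      carr = carr A,
      oper = (\<lambda>s xs. case s of Base f \<Rightarrow> oper A f xs | Const t c \<Rightarrow> c)\<rparr>"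

datatype 'f preexp = PNode 'f "'f preexp list"

fun pre_out :: "('t, 'f) signature \<Rightarrow> 'f preexp \<Rightarrow> 't" where
  "pre_out S (PNode f es) = outT S f"

fun pre_in :: "('t, 'f) signature \<Rightarrow> 'f preexp \<Rightarrow> 't list" where
  "pre_in S (PNode f es) = (if es = [] then inT S f else concat (map (pre_in S) es))"

fun is_preexp :: "('t, 'f) signature \<Rightarrow> 'f preexp \<Rightarrow> bool" where
  "is_preexp S (PNode f es) \<longleftrightarrow>
     f \<in> syms S \<and> (es = [] \<or> map (pre_out S) es = inT S f) \<and> (\<forall>e \<in> set es. is_preexp S e)"

text \<open>The argument list is consumed by the leaves from left to right.\<close>

fun pre_eval :: "('t, 'f, 'c) algebra \<Rightarrow> 'f preexp \<Rightarrow> 'c list \<Rightarrow> 'c"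
  and pre_evals :: "('t, 'f, 'c) algebra \<Rightarrow> 'f preexp list \<Rightarrow> 'c list \<Rightarrow> 'c list" where
  "pre_eval A (PNode f es) xs = oper A f (if es = [] then xs else pre_evals A es xs)"
| "pre_evals A [] xs = []"
| "pre_evals A (e # es) xs =
     (let k = length (pre_in (sig A) e)
      in pre_eval A e (take k xs) # pre_evals A es (drop k xs))"

datatype 'f flsym = Orig 'f | Pre "'f preexp"

definition flatten_sig :: "('t, 'f) signature \<Rightarrow> ('t, 'f flsym) signature" where
  "flatten_sig S =
     \<lparr>sorts = sorts S,
      syms = Orig ` syms S \<union> Pre ` {e. is_preexp S e},
      inT = (\<lambda>s. case s of Orig f \<Rightarrow> inT S f | Pre e \<Rightarrow> pre_in S e),
      outT = (\<lambda>s. case s of Orig f \<Rightarrow> outT S f | Pre e \<Rightarrow> pre_out S e)\<rparr>"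

definition flatten_alg :: "('t, 'f, 'c) algebra \<Rightarrow> ('t, 'f flsym, 'c) algebra" where
  "flatten_alg A =
     \<lparr>sig = flatten_sig (sig A),
      carr = carr A,
      oper = (\<lambda>s xs. case s of Orig f \<Rightarrow> oper A f xs | Pre e \<Rightarrow> pre_eval A e xs)\<rparr>"

text \<open>That the carriers of \<open>B\<close> are closed under the operations is part of \<open>is_algebra B\<close>.\<close>

definition subalgebra :: "('t, 'f, 'c) algebra \<Rightarrow> ('t, 'f, 'c) algebra \<Rightarrow> bool" where
  "subalgebra B A \<longleftrightarrow>
     is_algebra B \<and>
     sorts (sig B) = sorts (sig A) \<and>
     syms (sig B) \<subseteq> syms (sig A) \<and>
     (\<forall>f \<in> syms (sig B). inT (sig B) f = inT (sig A) f \<and> outT (sig B) f = outT (sig A) f) \<and>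
     (\<forall>t \<in> sorts (sig B). carr B t \<subseteq> carr A t) \<and>
     (\<forall>f \<in> syms (sig B). \<forall>xs \<in> args B (inT (sig B) f). oper B f xs = oper A f xs)"

definition inherited ::
  "('t, ('t, 'f, 'c) clsym flsym, 'c) algebra \<Rightarrow> ('t, 'f, 'c) algebra \<Rightarrow> bool" where
  "inherited B A \<longleftrightarrow> subalgebra B (flatten_alg (closure_alg A))"


section \<open>Graphs\<close>

record 'a hgraph =
  verts :: "'a set"
  edges :: "'a set"
  ends :: "'a \<Rightarrow> 'a list"

text \<open>The map \<open>t\<close> from \<open>{1,\<dots>,n}\<close> to the vertices is the list \<open>[t(1),\<dots>,t(n)]\<close>, so that \<open>t(i)\<close> is
  the entry at position \<open>i - 1\<close>.\<close>

record 'a thgraph = "'a hgraph" +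
  terms :: "'a list"

definition is_hgraph :: "('a, 'x) hgraph_scheme \<Rightarrow> bool" where
  "is_hgraph G \<longleftrightarrow>
     finite (verts G) \<and> verts G \<noteq> {} \<and> finite (edges G) \<and> verts G \<inter> edges G = {} \<and>
     (\<forall>e \<in> edges G. ends G e \<noteq> [] \<and> set (ends G e) \<subseteq> verts G)"

definition is_thgraph :: "'a thgraph \<Rightarrow> bool" where
  "is_thgraph G \<longleftrightarrow> is_hgraph G \<and> set (terms G) \<subseteq> verts G"

definition thgraph_iso :: "'a thgraph \<Rightarrow> 'b thgraph \<Rightarrow> bool" where
  "thgraph_iso G H \<longleftrightarrow>
     (\<exists>f g. bij_betw f (verts G) (verts H) \<and> bij_betw g (edges G) (edges H) \<and>
        (\<forall>e \<in> edges G. ends H (g e) = map f (ends G e)) \<and>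
        terms H = map f (terms G))"


section \<open>Counting monadic second-order logic\<close>

text \<open>Individual variables and set variables are two separate copies of \<open>nat\<close>.\<close>

datatype cmso =
    FVert nat
  | FEdge nat
  | FEq nat nat
  | FMem nat nat          \<comment> \<open>\<open>FMem X x\<close> is the atom \<open>X(x)\<close>\<close>
  | FConn nat "nat list"
  | FCard nat nat nat     \<comment> \<open>modulus \<open>p\<close>, residue \<open>r\<close>, set variable\<close>
  | FNeg cmso
  | FAnd cmso cmso
  | FAllI nat cmso
  | FAllS nat cmso

primrec is_formula :: "cmso \<Rightarrow> bool" where
  "is_formula (FVert x) \<longleftrightarrow> True"
| "is_formula (FEdge x) \<longleftrightarrow> True"
| "is_formula (FEq x y) \<longleftrightarrow> True"
| "is_formula (FMem X x) \<longleftrightarrow> True"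
| "is_formula (FConn y xs) \<longleftrightarrow> True"
| "is_formula (FCard p r X) \<longleftrightarrow> 0 < p \<and> r \<le> p"
| "is_formula (FNeg \<phi>) \<longleftrightarrow> is_formula \<phi>"
| "is_formula (FAnd \<phi> \<psi>) \<longleftrightarrow> is_formula \<phi> \<and> is_formula \<psi>"
| "is_formula (FAllI x \<phi>) \<longleftrightarrow> is_formula \<phi>"
| "is_formula (FAllS X \<phi>) \<longleftrightarrow> is_formula \<phi>"

primrec free_ind :: "cmso \<Rightarrow> nat set" where
  "free_ind (FVert x) = {x}"
| "free_ind (FEdge x) = {x}"
| "free_ind (FEq x y) = {x, y}"
| "free_ind (FMem X x) = {x}"
| "free_ind (FConn y xs) = insert y (set xs)"
| "free_ind (FCard p r X) = {}"
| "free_ind (FNeg \<phi>) = free_ind \<phi>"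
| "free_ind (FAnd \<phi> \<psi>) = free_ind \<phi> \<union> free_ind \<psi>"
| "free_ind (FAllI x \<phi>) = free_ind \<phi> - {x}"
| "free_ind (FAllS X \<phi>) = free_ind \<phi>"

primrec free_set :: "cmso \<Rightarrow> nat set" where
  "free_set (FVert x) = {}"
| "free_set (FEdge x) = {}"
| "free_set (FEq x y) = {}"
| "free_set (FMem X x) = {X}"
| "free_set (FConn y xs) = {}"
| "free_set (FCard p r X) = {X}"
| "free_set (FNeg \<phi>) = free_set \<phi>"
| "free_set (FAnd \<phi> \<psi>) = free_set \<phi> \<union> free_set \<psi>"
| "free_set (FAllI x \<phi>) = free_set \<phi>"
| "free_set (FAllS X \<phi>) = free_set \<phi> - {X}"

definition sentence :: "cmso \<Rightarrow> bool" where
  "sentence \<phi> \<longleftrightarrow> is_formula \<phi> \<and> free_ind \<phi> = {} \<and> free_set \<phi> = {}"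

text \<open>A set variable denotes a set of vertices or a set of edges, never a mixed set.\<close>

primrec sat ::
  "('a, 'x) hgraph_scheme \<Rightarrow> (nat \<Rightarrow> 'a) \<Rightarrow> (nat \<Rightarrow> 'a set) \<Rightarrow> cmso \<Rightarrow> bool" where
  "sat G i s (FVert x) \<longleftrightarrow> i x \<in> verts G"
| "sat G i s (FEdge x) \<longleftrightarrow> i x \<in> edges G"
| "sat G i s (FEq x y) \<longleftrightarrow> i x = i y"
| "sat G i s (FMem X x) \<longleftrightarrow> i x \<in> s X"
| "sat G i s (FConn y xs) \<longleftrightarrow> i y \<in> edges G \<and> ends G (i y) = map i xs"
| "sat G i s (FCard p r X) \<longleftrightarrow> card (s X) mod p = r mod p"
| "sat G i s (FNeg \<phi>) \<longleftrightarrow> \<not> sat G i s \<phi>"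
| "sat G i s (FAnd \<phi> \<psi>) \<longleftrightarrow> sat G i s \<phi> \<and> sat G i s \<psi>"
| "sat G i s (FAllI x \<phi>) \<longleftrightarrow> (\<forall>a \<in> verts G \<union> edges G. sat G (i(x := a)) s \<phi>)"
| "sat G i s (FAllS X \<phi>) \<longleftrightarrow>
     (\<forall>A \<in> Pow (verts G) \<union> Pow (edges G). sat G i (s(X := A)) \<phi>)"

definition hmodels :: "('a, 'x) hgraph_scheme \<Rightarrow> cmso \<Rightarrow> bool" where
  "hmodels G \<phi> \<longleftrightarrow>
     (\<forall>i s. range i \<subseteq> verts G \<union> edges G \<longrightarrow> range s \<subseteq> Pow (verts G) \<union> Pow (edges G) \<longrightarrow>
        sat G i s \<phi>)"


section \<open>Operations on concrete graphs\<close>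

definition raw_sum :: "nat thgraph \<Rightarrow> nat thgraph \<Rightarrow> nat thgraph" where
  "raw_sum G H =
     (let l = (\<lambda>x. 2 * x); r = (\<lambda>x. 2 * x + 1) in
      \<lparr>verts = l ` verts G \<union> r ` verts H,
       edges = l ` edges G \<union> r ` edges H,
       ends = (\<lambda>e. if even e then map l (ends G (e div 2)) else map r (ends H (e div 2))),
       terms = map l (terms G) @ map r (terms H)\<rparr>)"

text \<open>In the next two operations positions in the list of terminals are counted from 0. Outside
  the intended range of indices the graph is returned unchanged; this case is never used.\<close>

definition raw_redef :: "nat list \<Rightarrow> 'a thgraph \<Rightarrow> 'a thgraph" where
  "raw_redef \<sigma> G =
     (if set \<sigma> \<subseteq> {..<length (terms G)} then G\<lparr>terms := map (nth (terms G)) \<sigma>\<rparr> else G)"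

definition raw_fuse :: "nat \<Rightarrow> nat \<Rightarrow> 'a thgraph \<Rightarrow> 'a thgraph" where
  "raw_fuse a b G =
     (if a < length (terms G) \<and> b < length (terms G) then
        (let q = id(terms G ! b := terms G ! a) in
         \<lparr>verts = q ` verts G, edges = edges G,
          ends = (\<lambda>e. map q (ends G e)), terms = map q (terms G)\<rparr>)
      else G)"

definition raw_vert :: "nat thgraph" where
  "raw_vert = \<lparr>verts = {0}, edges = {}, ends = (\<lambda>_. []), terms = [0]\<rparr>"

definition raw_edge :: "nat \<Rightarrow> nat thgraph" where
  "raw_edge n = \<lparr>verts = {..<n}, edges = {n}, ends = (\<lambda>_. [0..<n]), terms = [0..<n]\<rparr>"


section \<open>The algebra of graphs\<close>

text \<open>Typed graphs up to isomorphism. As graphs are finite, names taken from \<open>nat\<close> suffice.\<close>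

definition giso :: "nat thgraph \<Rightarrow> nat thgraph \<Rightarrow> bool" where
  "giso G H \<longleftrightarrow> is_thgraph G \<and> is_thgraph H \<and> thgraph_iso G H"

lemma thgraph_iso_refl: "thgraph_iso G G"
  unfolding thgraph_iso_def by (rule exI[of _ id], rule exI[of _ id]) simp

lemma thgraph_iso_sym:
  assumes "is_thgraph G" "thgraph_iso G H"
  shows "thgraph_iso H G"
proof -
  obtain f g where f: "bij_betw f (verts G) (verts H)" and g: "bij_betw g (edges G) (edges H)"
    and e: "\<forall>e \<in> edges G. ends H (g e) = map f (ends G e)" and t: "terms H = map f (terms G)"
    using assms(2) unfolding thgraph_iso_def by blast
  let ?f = "the_inv_into (verts G) f" and ?g = "the_inv_into (edges G) g"
  have inv: "map ?f (map f xs) = xs" if "set xs \<subseteq> verts G" for xs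
    using that f by (induction xs) (auto simp: bij_betw_def the_inv_into_f_f)
  have "ends G (?g e) = map ?f (ends H e)" if "e \<in> edges H" for e
  proof -
    have "?g e \<in> edges G" "g (?g e) = e"
      using g that by (auto simp: bij_betw_def the_inv_into_into f_the_inv_into_f)
    then show ?thesis
      using e inv[of "ends G (?g e)"] assms(1)
      by (metis is_thgraph_def is_hgraph_def)
  qed
  moreover have "terms G = map ?f (terms H)"
    using inv[of "terms G"] assms(1) t by (simp add: is_thgraph_def)
  ultimately show ?thesis
    unfolding thgraph_iso_def using f g bij_betw_the_inv_into by blast
qed

lemma thgraph_iso_trans:
  assumes "is_thgraph G" "thgraph_iso G H" "thgraph_iso H K"
  shows "thgraph_iso G K"
proof -
  obtain f g where 1: "bij_betw f (verts G) (verts H)" "bij_betw g (edges G) (edges H)"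
    "\<forall>e \<in> edges G. ends H (g e) = map f (ends G e)" "terms H = map f (terms G)"
    using assms(2) unfolding thgraph_iso_def by blast
  obtain f' g' where 2: "bij_betw f' (verts H) (verts K)" "bij_betw g' (edges H) (edges K)"
    "\<forall>e \<in> edges H. ends K (g' e) = map f' (ends H e)" "terms K = map f' (terms H)"
    using assms(3) unfolding thgraph_iso_def by blast
  have "\<forall>e \<in> edges G. ends K ((g' \<circ> g) e) = map (f' \<circ> f) (ends G e)"
    using 1 2 by (auto dest: bij_betwE)
  moreover have "terms K = map (f' \<circ> f) (terms G)" using 1 2 by simp
  ultimately show ?thesis
    unfolding thgraph_iso_def using bij_betw_trans 1(1,2) 2(1,2) by blast
qed

lemma is_thgraph_raw_vert: "is_thgraph raw_vert"
  by (auto simp: raw_vert_def is_thgraph_def is_hgraph_def)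

lemma is_thgraph_raw_edge: "1 \<le> n \<Longrightarrow> is_thgraph (raw_edge n)"
  by (auto simp: raw_edge_def is_thgraph_def is_hgraph_def lessThan_empty_iff)

quotient_type tgraph = "nat thgraph" / partial: giso
proof (rule part_equivpI)
  show "\<exists>x. giso x x"
    using is_thgraph_raw_vert thgraph_iso_refl by (auto simp: giso_def)
  show "symp giso"
    by (rule sympI) (auto simp: giso_def intro: thgraph_iso_sym)
  show "transp giso"
    by (rule transpI) (auto simp: giso_def intro: thgraph_iso_trans)
qed

lemma gisoE:
  assumes "giso G H"
  obtains f g where "is_thgraph G" "is_thgraph H"
    "bij_betw f (verts G) (verts H)" "bij_betw g (edges G) (edges H)"
    "\<And>e. e \<in> edges G \<Longrightarrow> ends H (g e) = map f (ends G e)" "terms H = map f (terms G)"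
  using assms unfolding giso_def thgraph_iso_def by blast

lemma giso_raw_sum:
  assumes "giso G G'" "giso H H'"
  shows "giso (raw_sum G H) (raw_sum G' H')"
proof -
  obtain f g where 1: "is_thgraph G" "is_thgraph G'"
    "bij_betw f (verts G) (verts G')" "bij_betw g (edges G) (edges G')"
    "\<And>e. e \<in> edges G \<Longrightarrow> ends G' (g e) = map f (ends G e)" "terms G' = map f (terms G)"
    using assms(1) by (rule gisoE) blast
  obtain f' g' where 2: "is_thgraph H" "is_thgraph H'"
    "bij_betw f' (verts H) (verts H')" "bij_betw g' (edges H) (edges H')"
    "\<And>e. e \<in> edges H \<Longrightarrow> ends H' (g' e) = map f' (ends H e)" "terms H' = map f' (terms H)"
    using assms(2) by (rule gisoE) blast
  have wf: "is_thgraph (raw_sum K L)" if "is_thgraph K" "is_thgraph L" for K L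
  proof -
    have "verts (raw_sum K L) \<inter> edges (raw_sum K L) = {}"
    proof -
      have "2 * x \<noteq> Suc (2 * y)" "Suc (2 * y) \<noteq> 2 * x" for x y :: nat by presburger+
      then show ?thesis
        using that by (auto simp: raw_sum_def Let_def is_thgraph_def is_hgraph_def)
    qed
    moreover have "ends (raw_sum K L) e \<noteq> [] \<and> set (ends (raw_sum K L) e) \<subseteq> verts (raw_sum K L)"
      if "e \<in> edges (raw_sum K L)" for e
    proof -
      have "(\<exists>e' \<in> edges K. e = 2 * e') \<or> (\<exists>e' \<in> edges L. e = 2 * e' + 1)"
        using that by (auto simp: raw_sum_def Let_def)
      then consider e' where "e' \<in> edges K" "e = 2 * e'"
        | e' where "e' \<in> edges L" "e = 2 * e' + 1" by blast
      then show ?thesis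
      proof cases
        case 1
        then have "set (ends K e') \<subseteq> verts K" "ends K e' \<noteq> []"
          using \<open>is_thgraph K\<close> by (auto simp: is_thgraph_def is_hgraph_def)
        then show ?thesis using 1 by (auto simp: raw_sum_def Let_def)
      next
        case 2
        then have "set (ends L e') \<subseteq> verts L" "ends L e' \<noteq> []"
          using \<open>is_thgraph L\<close> by (auto simp: is_thgraph_def is_hgraph_def)
        then show ?thesis using 2 by (auto simp: raw_sum_def Let_def)
      qed
    qed
    moreover have "set (terms (raw_sum K L)) \<subseteq> verts (raw_sum K L)"
      using that by (auto simp: raw_sum_def Let_def is_thgraph_def)
    moreover have "finite (verts (raw_sum K L))" "finite (edges (raw_sum K L))"
      "verts (raw_sum K L) \<noteq> {}"
      using that by (auto simp: raw_sum_def Let_def is_thgraph_def is_hgraph_def)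
    ultimately show ?thesis by (simp add: is_thgraph_def is_hgraph_def)
  qed
  define j :: "(nat \<Rightarrow> nat) \<Rightarrow> (nat \<Rightarrow> nat) \<Rightarrow> nat \<Rightarrow> nat" where
    "j p q x = (if even x then 2 * p (x div 2) else 2 * q (x div 2) + 1)" for p q x
  have bij: "bij_betw (j p q) ((\<lambda>x. 2 * x) ` P \<union> (\<lambda>x. 2 * x + 1) ` Q)
      ((\<lambda>x. 2 * x) ` P' \<union> (\<lambda>x. 2 * x + 1) ` Q')"
    if "bij_betw p P P'" "bij_betw q Q Q'" for p q P Q P' Q'
  proof (rule bij_betw_combine)
    have [simp]: "j p q (2 * x) = 2 * p x" "j p q (2 * x + 1) = 2 * q x + 1"
      "j p q (Suc (2 * x)) = Suc (2 * q x)" for x by (simp_all add: j_def)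
    have "inj_on (j p q) ((\<lambda>x. 2 * x) ` P)" "inj_on (j p q) ((\<lambda>x. 2 * x + 1) ` Q)"
      using that by (auto simp: bij_betw_def inj_on_def)
    then show "bij_betw (j p q) ((\<lambda>x. 2 * x) ` P) ((\<lambda>x. 2 * x) ` P')"
      "bij_betw (j p q) ((\<lambda>x. 2 * x + 1) ` Q) ((\<lambda>x. 2 * x + 1) ` Q')"
      using that by (simp_all add: bij_betw_def image_image
          flip: bij_betw_imp_surj_on[OF that(1)] bij_betw_imp_surj_on[OF that(2)])
    show "(\<lambda>x. 2 * x) ` P' \<inter> (\<lambda>x. 2 * x + 1) ` Q' = {}" by auto presburger
  qed
  have "thgraph_iso (raw_sum G H) (raw_sum G' H')"
    unfolding thgraph_iso_def
    apply (rule exI[of _ "j f f'"], rule exI[of _ "j g g'"])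
    using bij[OF 1(3) 2(3)] bij[OF 1(4) 2(4)] 1(5,6) 2(5,6)
    by (auto simp: raw_sum_def Let_def j_def)
  then show ?thesis using wf 1 2 by (simp add: giso_def)
qed

lemma giso_raw_redef:
  assumes "giso G H"
  shows "giso (raw_redef \<sigma> G) (raw_redef \<sigma> H)"
  using assms
proof (rule gisoE)
  fix f g
  assume 1: "is_thgraph G" "is_thgraph H"
    "bij_betw f (verts G) (verts H)" "bij_betw g (edges G) (edges H)"
    "\<And>e. e \<in> edges G \<Longrightarrow> ends H (g e) = map f (ends G e)" "terms H = map f (terms G)"
  have wf: "is_thgraph (raw_redef \<sigma> K)" if "is_thgraph K" for K :: "nat thgraph"
  proof -
    have "set (map (nth (terms K)) \<sigma>) \<subseteq> set (terms K)" if "set \<sigma> \<subseteq> {..<length (terms K)}"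
      using that by auto
    then show ?thesis
      using that by (auto simp: raw_redef_def is_thgraph_def is_hgraph_def subset_iff)
  qed
  have "thgraph_iso (raw_redef \<sigma> G) (raw_redef \<sigma> H)"
    unfolding thgraph_iso_def
    apply (rule exI[of _ f], rule exI[of _ g])
    using 1(3-6) by (auto simp: raw_redef_def)
  then show ?thesis using wf 1 by (simp add: giso_def)
qed

lemma giso_raw_fuse:
  assumes "giso G H"
  shows "giso (raw_fuse a b G) (raw_fuse a b H)"
  using assms
proof (rule gisoE)
  fix f g
  assume 1: "is_thgraph G" "is_thgraph H"
    "bij_betw f (verts G) (verts H)" "bij_betw g (edges G) (edges H)"
    "\<And>e. e \<in> edges G \<Longrightarrow> ends H (g e) = map f (ends G e)" "terms H = map f (terms G)"
  have mem: "terms K ! a \<in> verts K" "terms K ! b \<in> verts K"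
    if "is_thgraph K" "a < length (terms K)" "b < length (terms K)" for K :: "nat thgraph"
    using that nth_mem by (auto simp: is_thgraph_def)
  have wf: "is_thgraph (raw_fuse a b K)" if K: "is_thgraph K" for K :: "nat thgraph"
  proof (cases "a < length (terms K) \<and> b < length (terms K)")
    case True
    define q where "q = id(terms K ! b := terms K ! a)"
    have "q ` verts K \<subseteq> verts K" using mem K True by (auto simp: q_def)
    then have "q ` verts K \<inter> edges K = {}" using K by (auto simp: is_thgraph_def is_hgraph_def)
    moreover have "q ` set xs \<subseteq> q ` verts K" if "set xs \<subseteq> verts K" for xs
      using that by (rule image_mono)
    moreover have "raw_fuse a b K = \<lparr>verts = q ` verts K, edges = edges K,
        ends = (\<lambda>e. map q (ends K e)), terms = map q (terms K)\<rparr>"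
      using True by (simp add: raw_fuse_def q_def Let_def)
    ultimately show ?thesis
      using K by (simp add: is_thgraph_def is_hgraph_def)
  qed (use K in \<open>auto simp: raw_fuse_def\<close>)
  have "thgraph_iso (raw_fuse a b G) (raw_fuse a b H)"
  proof (cases "a < length (terms G) \<and> b < length (terms G)")
    case True
    define q where "q = id(terms G ! b := terms G ! a)"
    define q' where "q' = id(terms H ! b := terms H ! a)"
    have q: "q' (f x) = f (q x)" if "x \<in> verts G" for x
      using that True 1(3,6) mem[OF 1(1)] by (auto simp: q_def q'_def bij_betw_def inj_on_def)
    then have qs: "map q' (map f xs) = map f (map q xs)" if "set xs \<subseteq> verts G" for xs
      using that by (induction xs) auto
    have "q ` verts G \<subseteq> verts G" using mem[OF 1(1)] True by (auto simp: q_def)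
    moreover have "f ` q ` verts G = q' ` verts H"
    proof -
      have "q' ` verts H = (\<lambda>x. q' (f x)) ` verts G"
        using bij_betw_imp_surj_on[OF 1(3), symmetric] by (simp add: image_image)
      also have "\<dots> = (\<lambda>x. f (q x)) ` verts G" by (rule image_cong) (simp_all add: q)
      finally show ?thesis by (simp add: image_image)
    qed
    ultimately have "bij_betw f (q ` verts G) (q' ` verts H)"
      using inj_on_subset[OF bij_betw_imp_inj_on[OF 1(3)]] by (simp add: bij_betw_def)
    moreover have "\<forall>e \<in> edges G. map q' (ends H (g e)) = map f (map q (ends G e))"
    proof
      fix e assume e: "e \<in> edges G"
      then have "set (ends G e) \<subseteq> verts G" using 1(1) by (simp add: is_thgraph_def is_hgraph_def)
      then show "map q' (ends H (g e)) = map f (map q (ends G e))"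
        unfolding 1(5)[OF e] by (rule qs)
    qed
    moreover have "map q' (terms H) = map f (map q (terms G))"
      unfolding 1(6) using 1(1) by (intro qs) (simp add: is_thgraph_def)
    moreover have "raw_fuse a b G = \<lparr>verts = q ` verts G, edges = edges G,
        ends = (\<lambda>e. map q (ends G e)), terms = map q (terms G)\<rparr>"
      "raw_fuse a b H = \<lparr>verts = q' ` verts H, edges = edges H,
        ends = (\<lambda>e. map q' (ends H e)), terms = map q' (terms H)\<rparr>"
      using True 1(6) by (simp_all add: raw_fuse_def q_def q'_def Let_def)
    ultimately show ?thesis
      using 1(4) unfolding thgraph_iso_def by (intro exI[of _ f] exI[of _ g]) simp
  next
    case False
    then have "raw_fuse a b G = G" "raw_fuse a b H = H"
      using 1(6) by (auto simp: raw_fuse_def)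
    then show ?thesis using assms by (simp add: giso_def)
  qed
  then show ?thesis using wf 1 by (simp add: giso_def)
qed

lemma sat_transfer:
  assumes inj: "inj_on h (verts G \<union> edges G)"
    and hv: "h ` verts G = verts H" and he: "h ` edges G = edges H"
    and ends: "\<And>e. e \<in> edges G \<Longrightarrow> ends H (h e) = map h (ends G e)"
    and sub: "\<And>e. e \<in> edges G \<Longrightarrow> set (ends G e) \<subseteq> verts G"
  shows "range i \<subseteq> verts G \<union> edges G \<Longrightarrow> range s \<subseteq> Pow (verts G) \<union> Pow (edges G) \<Longrightarrow>
    sat H (h \<circ> i) (\<lambda>X. h ` s X) \<phi> \<longleftrightarrow> sat G i s \<phi>"
proof (induction \<phi> arbitrary: i s)
  have mem: "h x \<in> h ` P \<longleftrightarrow> x \<in> P" if "x \<in> verts G \<union> edges G" "P \<subseteq> verts G \<union> edges G" for x P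
    using inj that by (auto simp: inj_on_def)
  have sets: "s X \<subseteq> verts G \<union> edges G" if "range s \<subseteq> Pow (verts G) \<union> Pow (edges G)"
    for s :: "nat \<Rightarrow> _" and X using that by (auto simp: image_subset_iff)
  {
    case (FVert x)
    then show ?case using mem[of "i x" "verts G"] hv by auto
  next
    case (FEdge x)
    then show ?case using mem[of "i x" "edges G"] he by auto
  next
    case (FEq x y)
    then have "i x \<in> verts G \<union> edges G" "i y \<in> verts G \<union> edges G" by auto
    then show ?case using inj by (auto simp: inj_on_def)
  next
    case (FMem X x)
    then show ?case using mem[of "i x" "s X"] sets[of s X] by auto
  next
    case (FConn y xs)
    have "h (i y) \<in> edges H \<longleftrightarrow> i y \<in> edges G"
      using FConn mem[of "i y" "edges G"] he by auto
    moreover have "ends H (h (i y)) = map (h \<circ> i) xs \<longleftrightarrow> ends G (i y) = map i xs"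
      if "i y \<in> edges G"
    proof -
      have "inj_on h (set (ends G (i y)) \<union> set (map i xs))"
        by (rule inj_on_subset[OF inj]) (use sub[OF that] FConn(1) in auto)
      then show ?thesis
        using ends[OF that] inj_on_map_eq_map[of h "ends G (i y)" "map i xs"] by simp
    qed
    ultimately show ?case by auto
  next
    case (FCard p r X)
    have "card (h ` s X) = card (s X)"
      using sets[OF FCard(2)] inj by (meson card_image inj_on_subset)
    then show ?case by simp
  next
    case (FAllI x \<phi>)
    have "sat H ((h \<circ> i)(x := h a)) (\<lambda>X. h ` s X) \<phi> \<longleftrightarrow> sat G (i(x := a)) s \<phi>"
      if "a \<in> verts G \<union> edges G" for a
    proof -
      have "(h \<circ> i)(x := h a) = h \<circ> (i(x := a))" by auto
      moreover have "range (i(x := a)) \<subseteq> verts G \<union> edges G"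
        using FAllI.prems(1) that by auto
      ultimately show ?thesis using FAllI.IH FAllI.prems(2) by metis
    qed
    moreover have "verts H \<union> edges H = h ` (verts G \<union> edges G)" using hv he by auto
    ultimately show ?case by (simp add: comp_def)
  next
    case (FAllS X \<phi>)
    have "sat H (h \<circ> i) ((\<lambda>X. h ` s X)(X := h ` P)) \<phi> \<longleftrightarrow> sat G i (s(X := P)) \<phi>"
      if "P \<in> Pow (verts G) \<union> Pow (edges G)" for P
    proof -
      have "(\<lambda>X. h ` s X)(X := h ` P) = (\<lambda>Y. h ` (s(X := P)) Y)"
        by (rule ext) simp
      moreover have "range (s(X := P)) \<subseteq> Pow (verts G) \<union> Pow (edges G)"
        using FAllS.prems(2) that by auto
      ultimately show ?thesis using FAllS.IH FAllS.prems(1) by metis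
    qed
    moreover have "Pow (verts H) \<union> Pow (edges H) = image h ` (Pow (verts G) \<union> Pow (edges G))"
      by (simp add: image_Un image_Pow_surj[OF hv] image_Pow_surj[OF he])
    ultimately show ?case by (simp add: comp_def)
  }
qed auto

lemma hmodels_giso:
  assumes "giso G H"
  shows "hmodels G = hmodels H"
proof -
  have "hmodels G \<phi>" if "giso G H" "hmodels H \<phi>" for G H \<phi>
    using that(1)
  proof (rule gisoE)
    fix f g
    assume 1: "is_thgraph G" "is_thgraph H"
      "bij_betw f (verts G) (verts H)" "bij_betw g (edges G) (edges H)"
      "\<And>e. e \<in> edges G \<Longrightarrow> ends H (g e) = map f (ends G e)" "terms H = map f (terms G)"
    have disj: "verts G \<inter> edges G = {}" "verts H \<inter> edges H = {}"
      and sub: "\<And>e. e \<in> edges G \<Longrightarrow> set (ends G e) \<subseteq> verts G"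
      using 1(1,2) by (auto simp: is_thgraph_def is_hgraph_def)
    define h where "h x = (if x \<in> verts G then f x else g x)" for x
    have bv: "bij_betw h (verts G) (verts H)"
      using 1(3) by (rule bij_betw_cong[THEN iffD1, rotated]) (simp add: h_def)
    have be: "bij_betw h (edges G) (edges H)"
      using 1(4) by (rule bij_betw_cong[THEN iffD1, rotated]) (use disj in \<open>auto simp: h_def\<close>)
    have inj: "inj_on h (verts G \<union> edges G)"
      using bij_betw_combine[OF bv be disj(2)] by (rule bij_betw_imp_inj_on)
    have hv: "h ` verts G = verts H" and he: "h ` edges G = edges H"
      using bv be by (auto simp: bij_betw_def)
    have ends: "ends H (h e) = map h (ends G e)" if "e \<in> edges G" for e
    proof -
      have "h e = g e" using that disj by (auto simp: h_def)
      moreover have "map h (ends G e) = map f (ends G e)" using sub[OF that] by (auto simp: h_def)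
      ultimately show ?thesis using 1(5) that by simp
    qed
    show "hmodels G \<phi>"
      unfolding hmodels_def
    proof (intro allI impI)
      fix i :: "nat \<Rightarrow> nat" and s :: "nat \<Rightarrow> nat set"
      assume v: "range i \<subseteq> verts G \<union> edges G" "range s \<subseteq> Pow (verts G) \<union> Pow (edges G)"
      have "range (h \<circ> i) \<subseteq> verts H \<union> edges H"
        using v(1) by (auto simp: image_subset_iff simp flip: hv he)
      moreover have "range (\<lambda>X. h ` s X) \<subseteq> Pow (verts H) \<union> Pow (edges H)"
      proof (rule image_subsetI)
        fix X
        have "s X \<subseteq> verts G \<or> s X \<subseteq> edges G" using v(2) by (simp add: image_subset_iff)
        then show "h ` s X \<in> Pow (verts H) \<union> Pow (edges H)"
          by (auto simp flip: hv he)
      qed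
      ultimately have "sat H (h \<circ> i) (\<lambda>X. h ` s X) \<phi>"
        using that(2) by (auto simp: hmodels_def)
      then show "sat G i s \<phi>"
        using sat_transfer[OF inj hv he ends sub v] by simp
    qed
  qed
  moreover have "giso H G" using assms by (auto simp: giso_def intro: thgraph_iso_sym)
  ultimately show ?thesis using assms by (intro ext iffI) blast+
qed

lift_definition gtype :: "tgraph \<Rightarrow> nat" is "\<lambda>G. length (terms G)"
  by (auto elim: gisoE)

lift_definition gsum :: "tgraph \<Rightarrow> tgraph \<Rightarrow> tgraph" is raw_sum
  by (rule giso_raw_sum)

lift_definition gredef :: "nat list \<Rightarrow> tgraph \<Rightarrow> tgraph" is raw_redef
  by (rule giso_raw_redef)

lift_definition gfuse :: "nat \<Rightarrow> nat \<Rightarrow> tgraph \<Rightarrow> tgraph" is raw_fuse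
  by (rule giso_raw_fuse)

lift_definition gvert :: tgraph is raw_vert
  by (simp add: giso_def is_thgraph_raw_vert thgraph_iso_refl)

text \<open>The value for \<open>n = 0\<close> is never used: there is no edge without end points.\<close>

lift_definition gedge :: "nat \<Rightarrow> tgraph" is "\<lambda>n. if 1 \<le> n then raw_edge n else raw_vert"
  by (simp add: giso_def is_thgraph_raw_vert is_thgraph_raw_edge thgraph_iso_refl)

lift_definition models :: "tgraph \<Rightarrow> cmso \<Rightarrow> bool" is hmodels
  by (rule hmodels_giso)

text \<open>A map \<open>\<sigma>\<close> from \<open>{1,\<dots>,n}\<close> to \<open>{1,\<dots>,m}\<close> is the list of length \<open>n\<close> of the numbers
  \<open>\<sigma>(i) - 1\<close>, and the indices of a fusion are likewise shifted by one.\<close>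

datatype gsym =
    DSum nat nat
  | Redef nat "nat list"   \<comment> \<open>\<open>m\<close> and \<open>\<sigma>\<close>\<close>
  | Fuse nat nat nat       \<comment> \<open>\<open>n\<close>, \<open>a\<close> and \<open>b\<close>\<close>
  | VertC
  | EdgeC nat

primrec gsym_in :: "gsym \<Rightarrow> nat list" where
  "gsym_in (DSum n m) = [n, m]"
| "gsym_in (Redef m \<sigma>) = [m]"
| "gsym_in (Fuse n a b) = [n]"
| "gsym_in VertC = []"
| "gsym_in (EdgeC n) = []"

primrec gsym_out :: "gsym \<Rightarrow> nat" where
  "gsym_out (DSum n m) = n + m"
| "gsym_out (Redef m \<sigma>) = length \<sigma>"
| "gsym_out (Fuse n a b) = n"
| "gsym_out VertC = 1"
| "gsym_out (EdgeC n) = n"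

fun gsym_op :: "gsym \<Rightarrow> tgraph list \<Rightarrow> tgraph" where
  "gsym_op (DSum n m) [G, H] = gsum G H"
| "gsym_op (Redef m \<sigma>) [G] = gredef \<sigma> G"
| "gsym_op (Fuse n a b) [G] = gfuse a b G"
| "gsym_op VertC [] = gvert"
| "gsym_op (EdgeC n) [] = gedge n"

definition graph_sig :: "(nat, gsym) signature" where
  "graph_sig =
     \<lparr>sorts = UNIV,
      syms = {DSum n m | n m. True} \<union> {Redef m \<sigma> | m \<sigma>. set \<sigma> \<subseteq> {..<m}} \<union>
        {Fuse n a b | n a b. a < n \<and> b < n} \<union> {VertC} \<union> {EdgeC n | n. 1 \<le> n},
      inT = gsym_in,
      outT = gsym_out\<rparr>"

definition graph_alg :: "(nat, gsym, tgraph) algebra" where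
  "graph_alg = \<lparr>sig = graph_sig, carr = (\<lambda>n. {G. gtype G = n}), oper = gsym_op\<rparr>"

lemma is_algebra_graph_alg: "is_algebra graph_alg"
proof -
  have sum: "gtype (gsum G H) = gtype G + gtype H" for G H
    by transfer (simp add: raw_sum_def Let_def)
  have redef: "gtype (gredef \<sigma> G) = length \<sigma>" if "set \<sigma> \<subseteq> {..<gtype G}" for \<sigma> G
    using that by transfer (simp add: raw_redef_def)
  have fuse: "gtype (gfuse a b G) = gtype G" for a b G
    by transfer (simp add: raw_fuse_def Let_def)
  have vert: "gtype gvert = 1" by transfer (simp add: raw_vert_def)
  have edge: "gtype (gedge n) = n" if "1 \<le> n" for n
    using that by transfer (simp add: raw_edge_def)
  have 2: "xs \<in> args A [s, t] \<longleftrightarrow> (\<exists>x y. xs = [x, y] \<and> x \<in> carr A s \<and> y \<in> carr A t)"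
    and 1: "xs \<in> args A [s] \<longleftrightarrow> (\<exists>x. xs = [x] \<and> x \<in> carr A s)"
    and 0: "xs \<in> args A [] \<longleftrightarrow> xs = []"
    for xs and A :: "(nat, gsym, tgraph) algebra" and s t
    by (auto simp: args_def list_all2_Cons2)
  show ?thesis
    unfolding is_algebra_def is_signature_def
    by (auto simp: graph_alg_def graph_sig_def 0 1 2 sum redef fuse vert edge simp del: One_nat_def)
qed

end

theory Submission
  imports Defs
begin

text \<open>Truth of a formula is shown to be determined by an invariant of graphs with assigned variables
  that takes finitely many values on each sort and whose value on the result of an operation depends
  only on its values on the arguments. Such invariants are built by recursion over the formula:
  pairing handles conjunction, and for a quantifier one collects the set of values over all
  assignments to the bound variable. Individuals are treated as singleton sets, so that an
  assignment on a disjoint sum splits into assignments on the summands. An invariant compatible with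
  the operations of an algebra is compatible with all its pre-expressions, hence with the operations
  of every inherited algebra, and its values there form the required locally finite algebra.\<close>

section \<open>Compatible maps on algebras\<close>

text \<open>Fusion is the obstacle that shapes the invariants: it can make two disjoint sets meet,
  so the truth of an atom on the argument does not settle its truth on the result. A new meeting can
  only take place at the fused vertex, and that vertex is a terminal. An atom is therefore
  accompanied by two further data: which terminals coincide, and which terminals lie in the sets
  concerned. Both are bounded in terms of the type, whence finiteness; local finiteness asks for it
  sort by sort. Every atom except \<open>FCard\<close> is brought into the single form
  \<open>S \<inter> T \<noteq> {}\<close>, or a conjunction of such statements, for sets that the
  operations transport, so that this analysis is made once. The passage to inherited algebras is
  cheap because compatibility survives composition, restriction of carriers and the addition of
  arbitrarily many constants.\<close>

definition compatible :: "('t, 'f, 'c) algebra \<Rightarrow> ('c \<Rightarrow> 'k) \<Rightarrow> bool" where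
  "compatible A k \<longleftrightarrow>
     (\<forall>f \<in> syms (sig A). \<forall>xs \<in> args A (inT (sig A) f). \<forall>ys \<in> args A (inT (sig A) f).
        map k xs = map k ys \<longrightarrow> k (oper A f xs) = k (oper A f ys))"

lemma compatibleD:
  assumes "compatible A k" "f \<in> syms (sig A)" "xs \<in> args A (inT (sig A) f)"
    "ys \<in> args A (inT (sig A) f)" "map k xs = map k ys"
  shows "k (oper A f xs) = k (oper A f ys)"
  using assms unfolding compatible_def by blast

lemma map2_Pair_eq_iff:
  assumes "length xs = length ts" "length ys = length ts"
  shows "map2 (\<lambda>t x. (t, k x)) ts xs = map2 (\<lambda>t x. (t, k x)) ts ys \<longleftrightarrow> map k xs = map k ys"
  using assms by (auto simp: list_eq_iff_nth_eq)

text \<open>Compatibility says that the kernel of \<open>k\<close> is a congruence; \<open>B\<close>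
  is the quotient, realised on the values of \<open>k\<close>.\<close>

lemma recognisable_compatible:
  fixes A :: "('t, 'f, 'c) algebra"
  assumes A: "is_algebra A" and t: "t \<in> sorts (sig A)" and k: "compatible A k"
    and fin: "\<And>s. s \<in> sorts (sig A) \<Longrightarrow> finite (k ` carr A s)"
    and P: "\<And>x y. x \<in> carr A t \<Longrightarrow> y \<in> carr A t \<Longrightarrow> k x = k y \<Longrightarrow> P x \<longleftrightarrow> P y"
  shows "recognisable A t {x \<in> carr A t. P x}"
proof -
  \<comment> \<open>The sort is attached because \<open>k\<close> may take the same value on
    different sorts, while carriers have to be disjoint.\<close>
  define h where "h s x = (s, k x)" for s :: 't and x
  \<comment> \<open>An operation of \<open>B\<close> is evaluated on arbitrarily chosen preimages of
    its arguments; compatibility makes the choice immaterial.\<close>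
  define rep where
    "rep f ys = (SOME xs. xs \<in> args A (inT (sig A) f) \<and> map2 h (inT (sig A) f) xs = ys)" for f ys
  define B where
    "B = \<lparr>sig = sig A, carr = (\<lambda>s. h s ` carr A s),
          oper = (\<lambda>f ys. h (outT (sig A) f) (oper A f (rep f ys)))\<rparr>"
  have rep: "rep f (map2 h (inT (sig A) f) xs) \<in> args A (inT (sig A) f) \<and>
      map2 h (inT (sig A) f) (rep f (map2 h (inT (sig A) f) xs)) = map2 h (inT (sig A) f) xs"
    if "xs \<in> args A (inT (sig A) f)" for f xs
    unfolding rep_def by (rule someI[of _ xs]) (simp add: that)
  have surj: "\<exists>xs \<in> args A ts. ys = map2 h ts xs" if "ys \<in> args B ts" for ys ts
  proof -
    have "\<forall>i < length ts. \<exists>x. x \<in> carr A (ts ! i) \<and> ys ! i = h (ts ! i) x"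
      using that by (auto simp: args_iff B_def)
    then obtain g where g: "\<forall>i < length ts. g i \<in> carr A (ts ! i) \<and> ys ! i = h (ts ! i) (g i)"
      by metis
    then have "map g [0..<length ts] \<in> args A ts" by (simp add: args_iff)
    moreover have "ys = map2 h ts (map g [0..<length ts])"
      using that g by (intro nth_equalityI) (auto simp: args_iff)
    ultimately show ?thesis by blast
  qed
  have op: "h (outT (sig A) f) (oper A f xs) = oper B f (map2 h (inT (sig A) f) xs)"
    if "f \<in> syms (sig A)" "xs \<in> args A (inT (sig A) f)" for f xs
  proof -
    let ?xs = "rep f (map2 h (inT (sig A) f) xs)"
    have xs: "?xs \<in> args A (inT (sig A) f)"
      "map2 h (inT (sig A) f) ?xs = map2 h (inT (sig A) f) xs"
      using rep[OF that(2)] by blast+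
    have "map k ?xs = map k xs"
      using xs that(2) map2_Pair_eq_iff[of ?xs "inT (sig A) f" xs k]
      by (simp add: args_iff h_def[abs_def])
    then have "k (oper A f ?xs) = k (oper A f xs)"
      using compatibleD[OF k that(1)] xs(1) that(2) by blast
    then show ?thesis by (simp add: B_def h_def)
  qed
  have "is_algebra B"
    unfolding is_algebra_def
  proof (intro conjI ballI impI)
    show "is_signature (sig B)" using A by (simp add: B_def is_algebra_def)
    show "carr B s \<inter> carr B u = {}" if "s \<noteq> u" for s u
      using that by (auto simp: B_def h_def)
    fix f ys assume f: "f \<in> syms (sig B)" and ys: "ys \<in> args B (inT (sig B) f)"
    then obtain xs where xs: "xs \<in> args A (inT (sig A) f)" "ys = map2 h (inT (sig A) f) xs"
      using surj by (auto simp: B_def)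
    have "oper A f xs \<in> carr A (outT (sig A) f)"
      using A f xs(1) by (auto simp: is_algebra_def B_def)
    moreover have "oper B f ys = h (outT (sig A) f) (oper A f xs)"
      using op f xs by (simp add: B_def)
    ultimately show "oper B f ys \<in> carr B (outT (sig B) f)" by (simp add: B_def)
  qed
  moreover have "finite (h s ` carr A s)" if "s \<in> sorts (sig A)" for s
    using finite_imageI[OF fin[OF that], of "Pair s"] by (simp add: h_def image_image)
  then have "locally_finite B"
    by (simp add: locally_finite_def B_def)
  moreover have "morphism A B h"
    using op by (simp add: morphism_def B_def)
  moreover have "h t ` {x \<in> carr A t. P x} \<subseteq> carr B t" by (auto simp: B_def)
  moreover have "{x \<in> carr A t. P x} = {x \<in> carr A t. h t x \<in> h t ` {x \<in> carr A t. P x}}"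
    using P by (auto simp: h_def)
  ultimately show ?thesis by (rule recognisableI[OF A t])
qed

section \<open>Compatibility under closure, flattening and passage to subalgebras\<close>

lemma is_algebra_closure_alg:
  assumes "is_algebra A"
  shows "is_algebra (closure_alg A)"
  using assms
  by (auto simp: is_algebra_def is_signature_def closure_alg_def closure_sig_def args_iff)

text \<open>A constant has no arguments to vary, so even infinitely many new constants impose no
  condition.\<close>

lemma compatible_closure_alg:
  assumes "compatible A k"
  shows "compatible (closure_alg A) k"
  unfolding compatible_def
proof (intro ballI impI)
  fix f xs ys
  assume "f \<in> syms (sig (closure_alg A))" "xs \<in> args (closure_alg A) (inT (sig (closure_alg A)) f)"
    "ys \<in> args (closure_alg A) (inT (sig (closure_alg A)) f)" "map k xs = map k ys"
  then show "k (oper (closure_alg A) f xs) = k (oper (closure_alg A) f ys)"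
    using compatibleD[OF assms] by (cases f) (auto simp: closure_alg_def closure_sig_def args_def)
qed

lemma args_append_iff:
  "xs \<in> args A (ts @ us) \<longleftrightarrow> take (length ts) xs \<in> args A ts \<and> drop (length ts) xs \<in> args A us"
  by (auto simp: args_def list_all2_append2 dest: list_all2_lengthD)
    (metis append_take_drop_id list_all2_lengthD)

lemma args_Cons_iff: "x # xs \<in> args A (t # ts) \<longleftrightarrow> x \<in> carr A t \<and> xs \<in> args A ts"
  by (simp add: args_def)

text \<open>Compatibility compares only arguments of the right sorts, so the intermediate values in
  an evaluation must be known to have them.\<close>

lemma pre_eval_carr:
  shows "is_algebra A \<Longrightarrow> is_preexp (sig A) e \<Longrightarrow> xs \<in> args A (pre_in (sig A) e) \<Longrightarrow>
      pre_eval A e xs \<in> carr A (pre_out (sig A) e)"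
    and "is_algebra A \<Longrightarrow> \<forall>e \<in> set es. is_preexp (sig A) e \<Longrightarrow>
      xs \<in> args A (concat (map (pre_in (sig A)) es)) \<Longrightarrow>
      pre_evals A es xs \<in> args A (map (pre_out (sig A)) es)"
proof (induction A e xs and A es xs rule: pre_eval_pre_evals.induct)
  case (1 A f es xs)
  then have "(if es = [] then xs else pre_evals A es xs) \<in> args A (inT (sig A) f)"
    by auto
  then show ?case using 1 by (simp add: is_algebra_def)
next
  case (3 A e es xs)
  then show ?case by (simp add: Let_def args_append_iff args_Cons_iff)
qed (simp add: args_def)

lemma compatible_pre_eval:
  shows "is_algebra A \<Longrightarrow> compatible A k \<Longrightarrow> is_preexp (sig A) e \<Longrightarrow>
      xs \<in> args A (pre_in (sig A) e) \<Longrightarrow> ys \<in> args A (pre_in (sig A) e) \<Longrightarrow>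
      map k xs = map k ys \<Longrightarrow> k (pre_eval A e xs) = k (pre_eval A e ys)"
    and "is_algebra A \<Longrightarrow> compatible A k \<Longrightarrow> \<forall>e \<in> set es. is_preexp (sig A) e \<Longrightarrow>
      xs \<in> args A (concat (map (pre_in (sig A)) es)) \<Longrightarrow>
      ys \<in> args A (concat (map (pre_in (sig A)) es)) \<Longrightarrow>
      map k xs = map k ys \<Longrightarrow> map k (pre_evals A es xs) = map k (pre_evals A es ys)"
proof (induction A e xs and A es xs arbitrary: ys and ys rule: pre_eval_pre_evals.induct)
  case (1 A f es xs)
  show ?case
  proof (cases "es = []")
    case True
    then show ?thesis using "1.prems" compatibleD[of A k f xs ys] by simp
  next
    case False
    have "map k (pre_evals A es xs) = map k (pre_evals A es ys)"
      by (rule "1.IH") (use "1.prems" False in simp_all)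
    moreover have "pre_evals A es zs \<in> args A (inT (sig A) f)"
      if "zs \<in> args A (pre_in (sig A) (PNode f es))" for zs
      using pre_eval_carr(2)[of A es zs] "1.prems"(1,3) False that by auto
    ultimately show ?thesis
      using "1.prems" False compatibleD[of A k f "pre_evals A es xs" "pre_evals A es ys"] by simp
  qed
next
  case (3 A e es xs)
  let ?n = "length (pre_in (sig A) e)"
  \<comment> \<open>Each subtree consumes a consecutive block of the arguments, and cutting into
    blocks commutes with applying \<open>k\<close>.\<close>
  have "map k (take ?n xs) = map k (take ?n ys)" "map k (drop ?n xs) = map k (drop ?n ys)"
    using "3.prems"(6) by (simp_all only: take_map[symmetric] drop_map[symmetric])
  then have "k (pre_eval A e (take ?n xs)) = k (pre_eval A e (take ?n ys))"
    "map k (pre_evals A es (drop ?n xs)) = map k (pre_evals A es (drop ?n ys))"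
    using "3.IH"(1)[OF refl, of "take ?n ys"] "3.IH"(2)[OF refl, of "drop ?n ys"] "3.prems"(1-5)
    by (simp_all add: args_append_iff)
  then show ?case by (simp add: Let_def)
qed auto

lemma compatible_flatten_alg:
  assumes "is_algebra A" "compatible A k"
  shows "compatible (flatten_alg A) k"
  unfolding compatible_def
proof (intro ballI impI)
  fix f xs ys
  assume "f \<in> syms (sig (flatten_alg A))" "xs \<in> args (flatten_alg A) (inT (sig (flatten_alg A)) f)"
    "ys \<in> args (flatten_alg A) (inT (sig (flatten_alg A)) f)" "map k xs = map k ys"
  then show "k (oper (flatten_alg A) f xs) = k (oper (flatten_alg A) f ys)"
    using compatibleD[OF assms(2), of _ xs ys] compatible_pre_eval(1)[OF assms, of _ xs ys]
    by (cases f) (auto simp: flatten_alg_def flatten_sig_def args_def)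
qed

lemma compatible_subalgebra:
  assumes B: "subalgebra B A" and k: "compatible A k"
  shows "compatible B k"
  unfolding compatible_def
proof (intro ballI impI)
  fix f xs ys
  assume f: "f \<in> syms (sig B)" and xs: "xs \<in> args B (inT (sig B) f)"
    and ys: "ys \<in> args B (inT (sig B) f)" and eq: "map k xs = map k ys"
  have S: "is_signature (sig B)" and sub: "\<And>t. t \<in> sorts (sig B) \<Longrightarrow> carr B t \<subseteq> carr A t"
    and fA: "f \<in> syms (sig A)" "inT (sig A) f = inT (sig B) f"
    and op: "\<And>zs. zs \<in> args B (inT (sig B) f) \<Longrightarrow> oper B f zs = oper A f zs"
    using B f by (auto simp: subalgebra_def is_algebra_def)
  \<comment> \<open>Carriers are compared only at sorts; the signature guarantees that all input
    types are sorts.\<close>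
  have "zs \<in> args A (inT (sig A) f)" if "zs \<in> args B (inT (sig B) f)" for zs
    using that S f sub nth_mem unfolding fA(2) args_iff is_signature_def by blast
  then show "k (oper B f xs) = k (oper B f ys)"
    using op xs ys compatibleD[OF k fA(1) _ _ eq] by simp
qed

lemma inherited_recognisable:
  assumes A: "is_algebra A" and B: "inherited B A" and t: "t \<in> sorts (sig A)"
    and k: "compatible A k" and fin: "\<And>s. s \<in> sorts (sig A) \<Longrightarrow> finite (k ` carr A s)"
    and P: "\<And>x y. x \<in> carr A t \<Longrightarrow> y \<in> carr A t \<Longrightarrow> k x = k y \<Longrightarrow> P x \<longleftrightarrow> P y"
  shows "recognisable B t {x \<in> carr B t. P x}"
proof (rule recognisable_compatible[of B t k])
  have sub: "subalgebra B (flatten_alg (closure_alg A))"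
    using B by (simp add: inherited_def)
  have sorts: "sorts (sig B) = sorts (sig A)"
    and carr: "\<And>s. s \<in> sorts (sig A) \<Longrightarrow> carr B s \<subseteq> carr A s"
    using sub
    by (auto simp: subalgebra_def flatten_alg_def flatten_sig_def closure_alg_def closure_sig_def)
  show "is_algebra B" using sub by (simp add: subalgebra_def)
  show "t \<in> sorts (sig B)" using t sorts by simp
  show "compatible B k"
    by (intro compatible_subalgebra[OF sub] compatible_flatten_alg is_algebra_closure_alg
        compatible_closure_alg A k)
  show "finite (k ` carr B s)" if "s \<in> sorts (sig B)" for s
    using fin[of s] carr[of s] that sorts by (metis finite_subset image_mono)
  show "P x \<longleftrightarrow> P y" if "x \<in> carr B t" "y \<in> carr B t" "k x = k y" for x y
    using P that carr[OF t] by blast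
qed

section \<open>Congruences on graphs with assigned variables\<close>

definition elems :: "('a, 'x) hgraph_scheme \<Rightarrow> 'a set" where
  "elems G = verts G \<union> edges G"

definition graph :: "nat \<Rightarrow> 'a thgraph \<Rightarrow> bool" where
  "graph n G \<longleftrightarrow> is_thgraph G \<and> length (terms G) = n"

text \<open>Singletons and unmixed sets are not enforced here: a singleton of a disjoint sum
  restricts to the empty set on one summand.\<close>

definition valued :: "('a, 'x) hgraph_scheme \<Rightarrow> ('v \<Rightarrow> 'a set) \<Rightarrow> bool" where
  "valued G X \<longleftrightarrow> (\<forall>v. X v \<subseteq> elems G)"

text \<open>One map on vertices and edges together, in contrast to the two bijections of
  \<open>thgraph_iso\<close>, since it has to carry along sets that may be mixed.\<close>

definition iso_map :: "('a \<Rightarrow> 'b) \<Rightarrow> 'a thgraph \<Rightarrow> 'b thgraph \<Rightarrow> bool" where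
  "iso_map h G H \<longleftrightarrow>
     inj_on h (elems G) \<and> h ` verts G = verts H \<and> h ` edges G = edges H \<and>
     (\<forall>e \<in> edges G. ends H (h e) = map h (ends G e)) \<and> terms H = map h (terms G)"

abbreviation left :: "nat \<Rightarrow> nat" where "left x \<equiv> 2 * x"

abbreviation right :: "nat \<Rightarrow> nat" where "right x \<equiv> Suc (2 * x)"

definition lpart :: "('v \<Rightarrow> nat set) \<Rightarrow> 'v \<Rightarrow> nat set" where
  "lpart X v = left -` X v"

definition rpart :: "('v \<Rightarrow> nat set) \<Rightarrow> 'v \<Rightarrow> nat set" where
  "rpart X v = right -` X v"

definition glue :: "nat \<Rightarrow> nat \<Rightarrow> 'a thgraph \<Rightarrow> 'a \<Rightarrow> 'a" where
  "glue a b G = id(terms G ! b := terms G ! a)"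

lemma left_right_neq [simp]: "2 * x \<noteq> Suc (2 * y)" "Suc (2 * y) \<noteq> 2 * x" for x y :: nat
  by presburger+

lemma graph_terms: "graph n G \<Longrightarrow> c < n \<Longrightarrow> terms G ! c \<in> verts G"
  using nth_mem by (auto simp: graph_def is_thgraph_def)

lemma graph_disjoint: "graph n G \<Longrightarrow> verts G \<inter> edges G = {}"
  by (simp add: graph_def is_thgraph_def is_hgraph_def)

lemma graph_ends: "graph n G \<Longrightarrow> e \<in> edges G \<Longrightarrow> set (ends G e) \<subseteq> verts G"
  by (simp add: graph_def is_thgraph_def is_hgraph_def)

lemma finite_elems: "graph n G \<Longrightarrow> finite (elems G)"
  by (simp add: graph_def is_thgraph_def is_hgraph_def elems_def)

lemma giso_refl: "is_thgraph G \<Longrightarrow> giso G G"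
  by (simp add: giso_def thgraph_iso_refl)

lemma raw_sum_sel [simp]:
  "verts (raw_sum G H) = left ` verts G \<union> right ` verts H"
  "edges (raw_sum G H) = left ` edges G \<union> right ` edges H"
  "ends (raw_sum G H) (2 * e) = map left (ends G e)"
  "ends (raw_sum G H) (Suc (2 * e)) = map right (ends H e)"
  "terms (raw_sum G H) = map left (terms G) @ map right (terms H)"
  by (simp_all add: raw_sum_def Let_def)

lemma elems_raw_sum: "elems (raw_sum G H) = left ` elems G \<union> right ` elems H"
  by (auto simp: elems_def)

lemma elems_raw_redef [simp]: "elems (raw_redef \<sigma> G) = elems G"
  by (simp add: elems_def raw_redef_def)

lemma raw_redef_sel:
  assumes "graph m G" "set \<sigma> \<subseteq> {..<m}"
  shows "verts (raw_redef \<sigma> G) = verts G" "edges (raw_redef \<sigma> G) = edges G"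
    "ends (raw_redef \<sigma> G) = ends G" "terms (raw_redef \<sigma> G) = map ((!) (terms G)) \<sigma>"
  using assms by (simp_all add: raw_redef_def graph_def)

lemma raw_fuse_sel:
  assumes "graph n G" "a < n" "b < n"
  shows "verts (raw_fuse a b G) = glue a b G ` verts G" "edges (raw_fuse a b G) = edges G"
    "ends (raw_fuse a b G) e = map (glue a b G) (ends G e)"
    "terms (raw_fuse a b G) = map (glue a b G) (terms G)"
  using assms by (simp_all add: raw_fuse_def graph_def glue_def Let_def)

lemma graph_raw_sum: "graph n G \<Longrightarrow> graph m H \<Longrightarrow> graph (n + m) (raw_sum G H)"
  using giso_raw_sum[OF giso_refl giso_refl, of G H] by (simp add: graph_def giso_def)

lemma graph_raw_redef:
  fixes G :: "nat thgraph"
  shows "graph m G \<Longrightarrow> set \<sigma> \<subseteq> {..<m} \<Longrightarrow> graph (length \<sigma>) (raw_redef \<sigma> G)"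
  using giso_raw_redef[OF giso_refl, of G \<sigma>]
  by (simp add: graph_def giso_def raw_redef_def)

lemma graph_raw_fuse:
  fixes G :: "nat thgraph"
  shows "graph n G \<Longrightarrow> a < n \<Longrightarrow> b < n \<Longrightarrow> graph n (raw_fuse a b G)"
  using giso_raw_fuse[OF giso_refl, of G a b]
  by (simp add: graph_def giso_def raw_fuse_def Let_def)

lemma glue_eq_iff:
  "glue a b G x = glue a b G y \<longleftrightarrow>
     x = y \<or> x \<in> {terms G ! a, terms G ! b} \<and> y \<in> {terms G ! a, terms G ! b}"
  by (auto simp: glue_def)

lemma glue_mem_image:
  "glue a b G x \<in> glue a b G ` S \<longleftrightarrow>
     x \<in> S \<or> x \<in> {terms G ! a, terms G ! b} \<and> (terms G ! a \<in> S \<or> terms G ! b \<in> S)"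
  by (auto simp: image_iff glue_eq_iff)

lemma glue_image_edges:
  assumes "graph n G" "a < n" "b < n" "S \<subseteq> edges G"
  shows "glue a b G ` S = S"
proof -
  have "terms G ! b \<notin> S"
    using graph_terms[OF assms(1,3)] graph_disjoint[OF assms(1)] assms(4) by auto
  then show ?thesis by (force simp: glue_def)
qed

text \<open>Phrased for subsets \<open>Y\<close> because both alternatives on the right can be read
  off from \<open>coincidences\<close> and \<open>trace\<close>, which is how
  \<open>regular_ex\<close> transfers them between graphs.\<close>

lemma elems_raw_fuse:
  assumes "graph n G" "a < n" "b < n"
  shows "Y \<subseteq> elems (raw_fuse a b G) \<longleftrightarrow>
     Y \<subseteq> elems G \<and> (terms G ! a = terms G ! b \<or> terms G ! b \<notin> Y)"
proof -
  have "elems (raw_fuse a b G) =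
      (if terms G ! a = terms G ! b then elems G else elems G - {terms G ! b})"
    using graph_terms[OF assms(1,2)] graph_terms[OF assms(1,3)] graph_disjoint[OF assms(1)]
    by (auto simp: elems_def raw_fuse_sel[OF assms] glue_def image_iff)
  then show ?thesis by auto
qed

text \<open>The only vertex that \<open>glue\<close> can move is the one missing from the fused
  graph.\<close>

lemma glue_image_fused:
  assumes "graph n G" "a < n" "b < n" "Y \<subseteq> elems (raw_fuse a b G)"
  shows "glue a b G ` Y = Y"
  using assms(4) by (force simp: elems_raw_fuse[OF assms(1-3)] glue_def)

lemma valued_parts:
  assumes "valued (raw_sum G H) X"
  shows "valued G (lpart X)" "valued H (rpart X)"
  using assms unfolding valued_def elems_raw_sum lpart_def rpart_def by fastforce+

lemma parts_union:
  assumes "valued (raw_sum G H) X"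
  shows "X v = left ` lpart X v \<union> right ` rpart X v"
  using assms unfolding valued_def elems_raw_sum lpart_def rpart_def by fastforce

lemma parts_of_union:
  "left -` (left ` Y \<union> right ` Z) = Y" "right -` (left ` Y \<union> right ` Z) = Z"
  by auto

lemma parts_upd:
  "lpart (X(v := Y)) = (lpart X)(v := left -` Y)" "rpart (X(v := Y)) = (rpart X)(v := right -` Y)"
  by (auto simp: lpart_def rpart_def fun_eq_iff)

lemma valued_fuse:
  assumes "graph n G" "a < n" "b < n" "valued (raw_fuse a b G) X"
  shows "valued G X"
  using assms(4) by (auto simp: valued_def elems_raw_fuse[OF assms(1-3)])

lemma valued_redef [simp]: "valued (raw_redef \<sigma> G) X \<longleftrightarrow> valued G X"
  by (simp add: valued_def)

lemma iso_map_elems: "iso_map h G H \<Longrightarrow> elems H = h ` elems G"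
  by (auto simp: iso_map_def elems_def)

text \<open>\<open>raw_fuse\<close> only deletes the vertex \<open>terms G ! b\<close> when it differs from \<open>terms G ! a\<close>, so the
  assignments on the fused graph are those on \<open>G\<close> that avoid this vertex, and \<open>X\<close> can be used on both
  sides.\<close>

locale graph_congruence =
  fixes \<theta> :: "nat thgraph \<Rightarrow> ('v \<Rightarrow> nat set) \<Rightarrow> 'k"
  assumes finite_range: "finite {\<theta> G X | G X. graph n G \<and> valued G X}"
    and iso: "graph n G \<Longrightarrow> graph n H \<Longrightarrow> valued G X \<Longrightarrow> iso_map h G H \<Longrightarrow>
      \<theta> H (\<lambda>v. h ` X v) = \<theta> G X"
    and sum: "graph n G \<Longrightarrow> graph n G' \<Longrightarrow> graph m H \<Longrightarrow> graph m H' \<Longrightarrow>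
      valued (raw_sum G H) X \<Longrightarrow> valued (raw_sum G' H') X' \<Longrightarrow>
      \<theta> G (lpart X) = \<theta> G' (lpart X') \<Longrightarrow> \<theta> H (rpart X) = \<theta> H' (rpart X') \<Longrightarrow>
      \<theta> (raw_sum G H) X = \<theta> (raw_sum G' H') X'"
    and redef: "graph n G \<Longrightarrow> graph n G' \<Longrightarrow> set \<sigma> \<subseteq> {..<n} \<Longrightarrow> valued G X \<Longrightarrow> valued G' X' \<Longrightarrow>
      \<theta> G X = \<theta> G' X' \<Longrightarrow> \<theta> (raw_redef \<sigma> G) X = \<theta> (raw_redef \<sigma> G') X'"
    and fuse: "graph n G \<Longrightarrow> graph n G' \<Longrightarrow> a < n \<Longrightarrow> b < n \<Longrightarrow>
      valued (raw_fuse a b G) X \<Longrightarrow> valued (raw_fuse a b G') X' \<Longrightarrow>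
      \<theta> G X = \<theta> G' X' \<Longrightarrow> \<theta> (raw_fuse a b G) X = \<theta> (raw_fuse a b G') X'"

section \<open>Properties determined by a congruence\<close>

definition determines ::
  "(nat thgraph \<Rightarrow> ('v \<Rightarrow> nat set) \<Rightarrow> 'k) \<Rightarrow> (nat thgraph \<Rightarrow> ('v \<Rightarrow> nat set) \<Rightarrow> 'p) \<Rightarrow> bool" where
  "determines \<theta> P \<longleftrightarrow>
     (\<forall>n G G' X X'. graph n G \<longrightarrow> graph n G' \<longrightarrow> valued G X \<longrightarrow> valued G' X' \<longrightarrow>
        \<theta> G X = \<theta> G' X' \<longrightarrow> P G X = P G' X')"

lemma determinesD:
  "determines \<theta> P \<Longrightarrow> graph n G \<Longrightarrow> graph n G' \<Longrightarrow> valued G X \<Longrightarrow> valued G' X' \<Longrightarrow>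
    \<theta> G X = \<theta> G' X' \<Longrightarrow> P G X = P G' X'"
  unfolding determines_def by blast

text \<open>The values are fixed to be natural numbers because a definition cannot quantify over
  types; \<open>regularI\<close> removes the restriction.\<close>

definition regular :: "(nat thgraph \<Rightarrow> ('v \<Rightarrow> nat set) \<Rightarrow> bool) \<Rightarrow> bool" where
  "regular P \<longleftrightarrow>
     (\<exists>\<theta> :: nat thgraph \<Rightarrow> ('v \<Rightarrow> nat set) \<Rightarrow> nat. graph_congruence \<theta> \<and> determines \<theta> P)"

lemma regularI:
  fixes \<theta> :: "nat thgraph \<Rightarrow> ('v \<Rightarrow> nat set) \<Rightarrow> 'k"
  assumes "graph_congruence \<theta>" and P: "determines \<theta> P"
  shows "regular P"
proof -
  interpret graph_congruence \<theta> by fact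
  \<comment> \<open>The values on all types together may be infinite in number, so each type gets
    its own coding. Codes may repeat across types, since only graphs of equal type are ever
    compared.\<close>
  have "\<exists>c :: 'k \<Rightarrow> nat. inj_on c {\<theta> G X | G X. graph n G \<and> valued G X}" for n
    using finite_imp_inj_to_nat_seg[OF finite_range] by blast
  then have "\<forall>n. \<exists>c :: 'k \<Rightarrow> nat. inj_on c {\<theta> G X | G X. graph n G \<and> valued G X}" ..
  from choice[OF this] obtain c :: "nat \<Rightarrow> 'k \<Rightarrow> nat"
    where c: "inj_on (c n) {\<theta> G X | G X. graph n G \<and> valued G X}" for n by blast
  define \<kappa> where "\<kappa> G X = c (length (terms G)) (\<theta> G X)" for G X
  have \<kappa>: "\<kappa> G X = \<kappa> G' X' \<longleftrightarrow> \<theta> G X = \<theta> G' X'"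
    if "graph n G" "graph n G'" "valued G X" "valued G' X'" for n G G' X X'
  proof -
    have "length (terms G) = n" "length (terms G') = n" using that by (simp_all add: graph_def)
    moreover have "\<theta> G X \<in> {\<theta> G X | G X. graph n G \<and> valued G X}"
      "\<theta> G' X' \<in> {\<theta> G X | G X. graph n G \<and> valued G X}"
      using that by blast+
    ultimately show ?thesis using inj_on_eq_iff[OF c[of n]] by (simp add: \<kappa>_def)
  qed
  have "graph_congruence \<kappa>"
  proof
    fix n
    have "{\<kappa> G X | G X. graph n G \<and> valued G X} = c n ` {\<theta> G X | G X. graph n G \<and> valued G X}"
      by (auto simp: \<kappa>_def graph_def image_iff)
    then show "finite {\<kappa> G X | G X. graph n G \<and> valued G X}" using finite_range by simp
  next
    fix n h and G H :: "nat thgraph" and X :: "'v \<Rightarrow> nat set"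
    assume "graph n G" "graph n H" "valued G X" "iso_map h G H"
    moreover from this have "valued H (\<lambda>v. h ` X v)"
      using iso_map_elems[of h G H] by (auto simp: valued_def)
    ultimately show "\<kappa> H (\<lambda>v. h ` X v) = \<kappa> G X" using \<kappa> iso by blast
  next
    fix n G G' m H H' X X'
    assume "graph n G" "graph n G'" "graph m H" "graph m H'" "valued (raw_sum G H) X"
      "valued (raw_sum G' H') X'" "\<kappa> G (lpart X) = \<kappa> G' (lpart X')" "\<kappa> H (rpart X) = \<kappa> H' (rpart X')"
    then show "\<kappa> (raw_sum G H) X = \<kappa> (raw_sum G' H') X'"
      using sum[of n G G' m H H' X X'] \<kappa>[of n G G'] \<kappa>[of m H H'] graph_raw_sum[of n _ m]
        \<kappa>[of "n + m" "raw_sum G H" "raw_sum G' H'"] valued_parts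
      by metis
  next
    fix n G G' \<sigma> X X'
    assume "graph n G" "graph n G'" "set \<sigma> \<subseteq> {..<n}" "valued G X" "valued G' X'" "\<kappa> G X = \<kappa> G' X'"
    then show "\<kappa> (raw_redef \<sigma> G) X = \<kappa> (raw_redef \<sigma> G') X'"
      using redef[of n G G' \<sigma> X X'] \<kappa>[of n G G'] graph_raw_redef[of n _ \<sigma>]
        \<kappa>[of "length \<sigma>" "raw_redef \<sigma> G" "raw_redef \<sigma> G'"]
      by simp
  next
    fix n G G' a b X X'
    assume "graph n G" "graph n G'" "a < n" "b < n" "valued (raw_fuse a b G) X"
      "valued (raw_fuse a b G') X'" "\<kappa> G X = \<kappa> G' X'"
    then show "\<kappa> (raw_fuse a b G) X = \<kappa> (raw_fuse a b G') X'"
      using fuse[of n G G' a b X X'] \<kappa>[of n G G'] graph_raw_fuse[of n _ a b]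
        \<kappa>[of n "raw_fuse a b G" "raw_fuse a b G'"] valued_fuse[of n _ a b]
      by metis
  qed
  moreover have "determines \<kappa> P"
    using determinesD[OF P] \<kappa> unfolding determines_def by blast
  ultimately show ?thesis unfolding regular_def by blast
qed

lemma graph_congruence_Pair:
  assumes "graph_congruence \<theta>1" "graph_congruence \<theta>2"
  shows "graph_congruence (\<lambda>G X. (\<theta>1 G X, \<theta>2 G X))"
proof -
  interpret one: graph_congruence \<theta>1 by fact
  interpret two: graph_congruence \<theta>2 by fact
  show ?thesis
  proof
    fix n
    have "{(\<theta>1 G X, \<theta>2 G X) | G X. graph n G \<and> valued G X} \<subseteq>
        {\<theta>1 G X | G X. graph n G \<and> valued G X} \<times> {\<theta>2 G X | G X. graph n G \<and> valued G X}"
      by blast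
    then show "finite {(\<theta>1 G X, \<theta>2 G X) | G X. graph n G \<and> valued G X}"
      using one.finite_range two.finite_range by (meson finite_SigmaI finite_subset)
  qed (auto intro: one.iso two.iso one.sum two.sum one.redef two.redef one.fuse two.fuse)
qed

lemma regular_not: "regular P \<Longrightarrow> regular (\<lambda>G X. \<not> P G X)"
  unfolding regular_def determines_def by meson

lemma regular_and:
  assumes "regular P" "regular Q"
  shows "regular (\<lambda>G X. P G X \<and> Q G X)"
proof -
  obtain \<theta>1 \<theta>2 :: "nat thgraph \<Rightarrow> ('a \<Rightarrow> nat set) \<Rightarrow> nat"
    where 1: "graph_congruence \<theta>1" "determines \<theta>1 P" and 2: "graph_congruence \<theta>2" "determines \<theta>2 Q"
    using assms unfolding regular_def by blast
  have "determines (\<lambda>G X. (\<theta>1 G X, \<theta>2 G X)) (\<lambda>G X. P G X \<and> Q G X)"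
    using determinesD[OF 1(2)] determinesD[OF 2(2)] unfolding determines_def by blast
  then show ?thesis by (rule regularI[OF graph_congruence_Pair[OF 1(1) 2(1)]])
qed

lemma regular_const: "regular (\<lambda>G X. c)"
proof (rule regularI[of "\<lambda>G X. ()"])
  show "graph_congruence (\<lambda>G X. ())" by standard auto
qed (simp add: determines_def)

section \<open>Regular properties\<close>

text \<open>Sets that each operation transports to the corresponding set of its result. The atoms
  other than \<open>FCard\<close> are statements that two such sets meet, or conjunctions of
  these.\<close>

locale equivariant =
  fixes S :: "nat thgraph \<Rightarrow> ('v \<Rightarrow> nat set) \<Rightarrow> nat set"
  assumes subset: "graph n G \<Longrightarrow> valued G X \<Longrightarrow> S G X \<subseteq> elems G"
    and iso: "graph n G \<Longrightarrow> graph n H \<Longrightarrow> valued G X \<Longrightarrow> iso_map h G H \<Longrightarrow>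
      S H (\<lambda>v. h ` X v) = h ` S G X"
    and sum: "graph n G \<Longrightarrow> graph m H \<Longrightarrow> valued (raw_sum G H) X \<Longrightarrow>
      S (raw_sum G H) X = left ` S G (lpart X) \<union> right ` S H (rpart X)"
    and redef: "graph n G \<Longrightarrow> set \<sigma> \<subseteq> {..<n} \<Longrightarrow> valued G X \<Longrightarrow> S (raw_redef \<sigma> G) X = S G X"
    and fuse: "graph n G \<Longrightarrow> a < n \<Longrightarrow> b < n \<Longrightarrow> valued (raw_fuse a b G) X \<Longrightarrow>
      S (raw_fuse a b G) X = glue a b G ` S G X"

text \<open>In the fusion case \<open>X\<close> is an assignment on the fused graph, hence fixed by
  \<open>glue\<close>.\<close>

lemma equivariant_var: "equivariant (\<lambda>G X. X v)"
proof
  fix n a b and G :: "nat thgraph" and X :: "'a \<Rightarrow> nat set"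
  assume "graph n G" "a < n" "b < n" "valued (raw_fuse a b G) X"
  then show "X v = glue a b G ` X v"
    by (simp add: glue_image_fused valued_def)
qed (rule parts_union | simp add: valued_def)+

lemma equivariant_verts: "equivariant (\<lambda>G X. verts G)"
  by standard (auto simp: elems_def iso_map_def raw_redef_sel raw_fuse_sel)

lemma equivariant_edges: "equivariant (\<lambda>G X. edges G)"
  by standard (auto simp: elems_def iso_map_def raw_redef_sel raw_fuse_sel glue_image_edges)

text \<open>Operations and isomorphisms rename end points but keep the lengths of words; this serves
  the length test in \<open>FConn\<close>.\<close>

lemma equivariant_edges_length: "equivariant (\<lambda>G X. {e \<in> edges G. length (ends G e) = k})"
proof
  fix n a b and G :: "nat thgraph" and X :: "'a \<Rightarrow> nat set"
  assume "graph n G" "a < n" "b < n"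
  then show "{e \<in> edges (raw_fuse a b G). length (ends (raw_fuse a b G) e) = k} =
      glue a b G ` {e \<in> edges G. length (ends G e) = k}"
    by (simp add: raw_fuse_sel glue_image_edges)
next
  fix n h and G H :: "nat thgraph" and X :: "'a \<Rightarrow> nat set"
  assume "iso_map h G H"
  then have "edges H = h ` edges G" "\<forall>e \<in> edges G. length (ends H (h e)) = length (ends G e)"
    by (simp_all add: iso_map_def)
  then show "{e \<in> edges H. length (ends H e) = k} = h ` {e \<in> edges G. length (ends G e) = k}"
    by auto
qed (auto simp: elems_def raw_redef_sel)

text \<open>Turns the condition of \<open>FConn\<close> on one end point, counted from 0, into a
  meeting of two sets. The guard on the length keeps \<open>!\<close> inside the word.\<close>

definition attached :: "'v \<Rightarrow> nat \<Rightarrow> 'a thgraph \<Rightarrow> ('v \<Rightarrow> 'a set) \<Rightarrow> 'a set" where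
  "attached v l G X = (\<lambda>e. ends G e ! l) ` {e \<in> X v \<inter> edges G. l < length (ends G e)}"

lemma equivariant_attached: "equivariant (attached v l)"
proof
  fix n and G :: "nat thgraph" and X :: "'a \<Rightarrow> nat set"
  assume G: "graph n G"
  have "ends G e ! l \<in> verts G" if "e \<in> edges G" "l < length (ends G e)" for e
    using graph_ends[OF G that(1)] that(2) by (meson nth_mem subsetD)
  then show "attached v l G X \<subseteq> elems G" by (auto simp: attached_def elems_def)
next
  fix n h and G H :: "nat thgraph" and X :: "'a \<Rightarrow> nat set"
  assume "graph n G" and X: "valued G X" and h: "iso_map h G H"
  \<comment> \<open>\<open>X v\<close> may contain vertices as well; injectivity on all elements
    keeps these from being sent to edges.\<close>
  have "h x \<in> edges H \<longleftrightarrow> x \<in> edges G" if "x \<in> X v" for x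
  proof -
    have "x \<in> elems G" using X that by (auto simp: valued_def)
    then show ?thesis using h unfolding iso_map_def elems_def
      by (metis Un_upper2 inj_on_image_mem_iff)
  qed
  then have "h ` X v \<inter> edges H = h ` (X v \<inter> edges G)" by auto
  moreover have ends: "\<forall>e \<in> edges G. ends H (h e) = map h (ends G e)"
    using h by (simp add: iso_map_def)
  ultimately have "{e \<in> h ` X v \<inter> edges H. l < length (ends H e)} =
      h ` {e \<in> X v \<inter> edges G. l < length (ends G e)}" by auto
  then show "attached v l H (\<lambda>v. h ` X v) = h ` attached v l G X"
    using ends by (simp add: attached_def image_image cong: image_cong_simp)
next
  fix n m and G H :: "nat thgraph" and X :: "'a \<Rightarrow> nat set"
  assume "valued (raw_sum G H) X"
  then have "X v \<inter> edges (raw_sum G H) = left ` (lpart X v \<inter> edges G) \<union> right ` (rpart X v \<inter> edges H)"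
    by (auto simp: lpart_def rpart_def)
  then have "{e \<in> X v \<inter> edges (raw_sum G H). l < length (ends (raw_sum G H) e)} =
      left ` {e \<in> lpart X v \<inter> edges G. l < length (ends G e)} \<union>
      right ` {e \<in> rpart X v \<inter> edges H. l < length (ends H e)}"
    by auto
  then show "attached v l (raw_sum G H) X =
      left ` attached v l G (lpart X) \<union> right ` attached v l H (rpart X)"
    by (simp add: attached_def image_Un image_image cong: image_cong_simp)
next
  fix n a b and G :: "nat thgraph" and X :: "'a \<Rightarrow> nat set"
  assume "graph n G" "a < n" "b < n"
  then show "attached v l (raw_fuse a b G) X = glue a b G ` attached v l G X"
    by (auto simp: attached_def raw_fuse_sel image_iff)
qed (simp add: attached_def raw_redef_sel)

section \<open>What the terminals reveal about a set\<close>

definition trace :: "'a thgraph \<Rightarrow> 'a set \<Rightarrow> nat set" where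
  "trace G S = {c. c < length (terms G) \<and> terms G ! c \<in> S}"

text \<open>The kernel of the terminal map. Fusion acts on sets only through terminals, so this
  relation and the traces contain what is needed to predict its effect.\<close>

definition coincidences :: "'a thgraph \<Rightarrow> (nat \<times> nat) set" where
  "coincidences G = {(c, d). c < length (terms G) \<and> d < length (terms G) \<and> terms G ! c = terms G ! d}"

lemma trace_iso:
  assumes "graph n G" "iso_map h G H" "S \<subseteq> elems G"
  shows "trace H (h ` S) = trace G S"
proof -
  have "h (terms G ! c) \<in> h ` S \<longleftrightarrow> terms G ! c \<in> S" if "c < n" for c
    using inj_on_image_mem_iff[of h "elems G" "terms G ! c" S] graph_terms[OF assms(1) that] assms(2,3)
    by (simp add: iso_map_def elems_def)
  then show ?thesis
    using assms(1,2) by (simp add: trace_def iso_map_def graph_def cong: conj_cong)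
qed

lemma coincidences_iso:
  assumes "graph n G" "iso_map h G H"
  shows "coincidences H = coincidences G"
proof -
  have "h (terms G ! c) = h (terms G ! d) \<longleftrightarrow> terms G ! c = terms G ! d" if "c < n" "d < n" for c d
    using inj_on_eq_iff[of h "elems G" "terms G ! c" "terms G ! d"] graph_terms[OF assms(1)] that
      assms(2) by (simp add: iso_map_def elems_def)
  then show ?thesis using assms by (auto simp: coincidences_def iso_map_def graph_def)
qed

lemma trace_sum:
  "trace (raw_sum G H) (left ` S \<union> right ` T) =
     trace G S \<union> (+) (length (terms G)) ` trace H T"
proof (rule set_eqI)
  fix c
  show "c \<in> trace (raw_sum G H) (left ` S \<union> right ` T) \<longleftrightarrow>
      c \<in> trace G S \<union> (+) (length (terms G)) ` trace H T"
  proof (cases "c < length (terms G)")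
    case True
    then show ?thesis by (auto simp: trace_def nth_append)
  next
    case False
    then obtain d where "c = length (terms G) + d" using le_Suc_ex not_less by blast
    then show ?thesis by (auto simp: trace_def nth_append)
  qed
qed

text \<open>Terminals of different summands never coincide, as their names differ in parity.\<close>

lemma coincidences_sum:
  "coincidences (raw_sum G H) =
     coincidences G \<union> map_prod ((+) (length (terms G))) ((+) (length (terms G))) ` coincidences H"
  (is "?L = ?R")
proof (rule set_eqI)
  fix p :: "nat \<times> nat"
  let ?n = "length (terms G)"
  obtain c d where p: "p = (c, d)" by (cases p)
  consider "c < ?n" "d < ?n" | d' where "c < ?n" "d = ?n + d'" | c' where "c = ?n + c'" "d < ?n"
    | c' d' where "c = ?n + c'" "d = ?n + d'"
    using le_Suc_ex not_less by metis
  then show "p \<in> ?L \<longleftrightarrow> p \<in> ?R"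
    by cases (auto simp: p coincidences_def nth_append)
qed

lemma trace_redef:
  assumes "graph m G" "set \<sigma> \<subseteq> {..<m}"
  shows "trace (raw_redef \<sigma> G) S = {c. c < length \<sigma> \<and> \<sigma> ! c \<in> trace G S}"
proof -
  have "\<sigma> ! c < m" if "c < length \<sigma>" for c using that assms(2) nth_mem by blast
  then show ?thesis using assms by (auto simp: trace_def raw_redef_sel graph_def)
qed

lemma coincidences_redef:
  assumes "graph m G" "set \<sigma> \<subseteq> {..<m}"
  shows "coincidences (raw_redef \<sigma> G) =
    {(c, d). c < length \<sigma> \<and> d < length \<sigma> \<and> (\<sigma> ! c, \<sigma> ! d) \<in> coincidences G}"
proof -
  have "\<sigma> ! c < m" if "c < length \<sigma>" for c using that assms(2) nth_mem by blast
  then show ?thesis using assms by (auto simp: coincidences_def raw_redef_sel graph_def)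
qed

text \<open>For \<open>E\<close> the coincidence relation: terminal \<open>c\<close> is one of the
  two vertices about to be identified.\<close>

definition glued :: "nat \<Rightarrow> nat \<Rightarrow> (nat \<times> nat) set \<Rightarrow> nat \<Rightarrow> bool" where
  "glued a b E c \<longleftrightarrow> (c, a) \<in> E \<or> (c, b) \<in> E"

text \<open>The fused vertex lies in the image of \<open>S\<close> as soon as one of the two
  identified vertices lies in \<open>S\<close>, and every terminal sitting at either of them then
  enters the trace.\<close>

lemma trace_fuse:
  assumes "graph n G" "a < n" "b < n"
  shows "trace (raw_fuse a b G) (glue a b G ` S) =
    {c. c < n \<and> (c \<in> trace G S \<or> glued a b (coincidences G) c \<and> (a \<in> trace G S \<or> b \<in> trace G S))}"
proof -
  have "glue a b G (terms G ! c) \<in> glue a b G ` S \<longleftrightarrow>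
      c \<in> trace G S \<or> glued a b (coincidences G) c \<and> (a \<in> trace G S \<or> b \<in> trace G S)"
    if "c < n" for c
    unfolding glue_mem_image
    using assms that by (auto simp: trace_def glued_def coincidences_def graph_def)
  then show ?thesis
    using assms
    by (simp add: trace_def[of "raw_fuse a b G"] raw_fuse_sel graph_def cong: conj_cong)
qed

lemma coincidences_fuse:
  assumes "graph n G" "a < n" "b < n"
  shows "coincidences (raw_fuse a b G) =
    {(c, d). c < n \<and> d < n \<and> ((c, d) \<in> coincidences G \<or>
       glued a b (coincidences G) c \<and> glued a b (coincidences G) d)}"
  using assms
  by (auto simp: raw_fuse_sel glued_def coincidences_def graph_def glue_eq_iff)

text \<open>Only the vertices at \<open>a\<close> and \<open>b\<close> are identified, so a new
  common element must be the fused vertex, and it is common when each set contains at least one of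
  the two.\<close>

lemma meets_fuse:
  assumes "graph n G" "a < n" "b < n"
  shows "glue a b G ` S \<inter> glue a b G ` T \<noteq> {} \<longleftrightarrow>
    S \<inter> T \<noteq> {} \<or> (a \<in> trace G S \<or> b \<in> trace G S) \<and> (a \<in> trace G T \<or> b \<in> trace G T)"
proof -
  have "glue a b G ` S \<inter> glue a b G ` T \<noteq> {} \<longleftrightarrow> (\<exists>x \<in> S. glue a b G x \<in> glue a b G ` T)"
    by blast
  then show ?thesis using assms by (auto simp: glue_mem_image trace_def graph_def)
qed

text \<open>The last component is the property of interest; the first three make it predictable
  after a fusion and are themselves predictable after every operation.\<close>

definition meet_info where
  "meet_info S T G X =
     (coincidences G, trace G (S G X), trace G (T G X), S G X \<inter> T G X \<noteq> {})"

lemma graph_congruence_meet_info: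
  assumes "equivariant S" "equivariant T"
  shows "graph_congruence (meet_info S T)"
proof -
  interpret S: equivariant S by fact
  interpret T: equivariant T by fact
  show ?thesis
  proof
    fix n
    have "{meet_info S T G X | G X. graph n G \<and> valued G X} \<subseteq>
        Pow ({..<n} \<times> {..<n}) \<times> Pow {..<n} \<times> Pow {..<n} \<times> UNIV"
      by (auto simp: meet_info_def coincidences_def trace_def graph_def)
    then show "finite {meet_info S T G X | G X. graph n G \<and> valued G X}"
      by (rule finite_subset) simp
  next
    fix n h and G H :: "nat thgraph" and X :: "'a \<Rightarrow> nat set"
    assume *: "graph n G" "graph n H" "valued G X" "iso_map h G H"
    \<comment> \<open>Images commute with the intersection because \<open>h\<close> is injective on
      all elements.\<close>
    have "h ` S G X \<inter> h ` T G X = h ` (S G X \<inter> T G X)"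
      using inj_on_image_Int[of h "elems G"] *(4) S.subset[OF *(1,3)] T.subset[OF *(1,3)]
      by (metis iso_map_def)
    then show "meet_info S T H (\<lambda>v. h ` X v) = meet_info S T G X"
      using * S.subset[OF *(1,3)] T.subset[OF *(1,3)]
      by (simp add: meet_info_def S.iso[OF *] T.iso[OF *] trace_iso[OF *(1,4)]
          coincidences_iso[OF *(1,4)])
  next
    fix n m and G G' H H' :: "nat thgraph" and X X' :: "'a \<Rightarrow> nat set"
    assume *: "graph n G" "graph n G'" "graph m H" "graph m H'"
      "valued (raw_sum G H) X" "valued (raw_sum G' H') X'"
      and eq: "meet_info S T G (lpart X) = meet_info S T G' (lpart X')"
      "meet_info S T H (rpart X) = meet_info S T H' (rpart X')"
    have meet: "(left ` A \<union> right ` B) \<inter> (left ` C \<union> right ` D) \<noteq> {} \<longleftrightarrow>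
        A \<inter> C \<noteq> {} \<or> B \<inter> D \<noteq> {}" for A B C D by auto
    \<comment> \<open>This length is the offset by which the terminals of the second summand are
      shifted.\<close>
    have "length (terms G) = length (terms G')" using *(1,2) by (simp add: graph_def)
    then show "meet_info S T (raw_sum G H) X = meet_info S T (raw_sum G' H') X'"
      using eq unfolding meet_info_def S.sum[OF *(1,3,5)] S.sum[OF *(2,4,6)]
        T.sum[OF *(1,3,5)] T.sum[OF *(2,4,6)] trace_sum coincidences_sum meet
      by simp
  next
    fix n \<sigma> and G G' :: "nat thgraph" and X X' :: "'a \<Rightarrow> nat set"
    assume "graph n G" "graph n G'" "set \<sigma> \<subseteq> {..<n}" "valued G X" "valued G' X'"
      "meet_info S T G X = meet_info S T G' X'"
    then show "meet_info S T (raw_redef \<sigma> G) X = meet_info S T (raw_redef \<sigma> G') X'"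
      by (simp add: meet_info_def S.redef T.redef trace_redef coincidences_redef)
  next
    fix n a b and G G' :: "nat thgraph" and X X' :: "'a \<Rightarrow> nat set"
    assume *: "graph n G" "graph n G'" "a < n" "b < n" "valued (raw_fuse a b G) X"
      "valued (raw_fuse a b G') X'" and eq: "meet_info S T G X = meet_info S T G' X'"
    show "meet_info S T (raw_fuse a b G) X = meet_info S T (raw_fuse a b G') X'"
      using eq unfolding meet_info_def S.fuse[OF *(1,3,4,5)] S.fuse[OF *(2,3,4,6)]
        T.fuse[OF *(1,3,4,5)] T.fuse[OF *(2,3,4,6)] trace_fuse[OF *(1,3,4)] trace_fuse[OF *(2,3,4)]
        coincidences_fuse[OF *(1,3,4)] coincidences_fuse[OF *(2,3,4)]
        meets_fuse[OF *(1,3,4)] meets_fuse[OF *(2,3,4)]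
      by simp
  qed
qed

lemma regular_meets:
  assumes "equivariant S" "equivariant T"
  shows "regular (\<lambda>G X. S G X \<inter> T G X \<noteq> {})"
  by (rule regularI[OF graph_congruence_meet_info[OF assms]])
    (simp add: determines_def meet_info_def)

text \<open>The kernel of \<open>f\<close> is a congruence of finite index on the natural numbers
  under addition, and cardinalities add in a disjoint sum. Redefinition and fusion keep
  \<open>X\<close> itself, so their conditions are literally the premises.\<close>

lemma regular_card:
  fixes f :: "nat \<Rightarrow> 'k"
  assumes fin: "finite (range f)"
    and add: "\<And>x x' y y'. f x = f x' \<Longrightarrow> f y = f y' \<Longrightarrow> f (x + y) = f (x' + y')"
    and P: "\<And>x y. f x = f y \<Longrightarrow> P x \<longleftrightarrow> P y"
  shows "regular (\<lambda>G X. P (card (X v)))"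
proof (rule regularI[of "\<lambda>G X. f (card (X v))"])
  show "graph_congruence (\<lambda>G X. f (card (X v)))"
  proof
    fix n
    show "finite {f (card (X v)) | G X. graph n G \<and> valued G X}"
      by (rule finite_subset[OF _ fin]) blast
  next
    fix n h and G H :: "nat thgraph" and X :: "'a \<Rightarrow> nat set"
    assume "valued G X" "iso_map h G H"
    then have "inj_on h (X v)" by (auto simp: valued_def iso_map_def intro: inj_on_subset)
    then show "f (card (h ` X v)) = f (card (X v))" by (simp add: card_image)
  next
    fix n m and G G' H H' :: "nat thgraph" and X X' :: "'a \<Rightarrow> nat set"
    assume *: "graph n G" "graph n G'" "graph m H" "graph m H'"
      "valued (raw_sum G H) X" "valued (raw_sum G' H') X'"
      and eq: "f (card (lpart X v)) = f (card (lpart X' v))"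
      "f (card (rpart X v)) = f (card (rpart X' v))"
    have card: "card (X v) = card (lpart X v) + card (rpart X v)"
      if "graph n G" "graph m H" "valued (raw_sum G H) X" for G H and X :: "'a \<Rightarrow> nat set"
    proof -
      have "finite (lpart X v)" "finite (rpart X v)"
        using valued_parts[OF that(3)] finite_elems[OF that(1)] finite_elems[OF that(2)]
        by (meson finite_subset valued_def)+
      then have "card (left ` lpart X v \<union> right ` rpart X v) =
          card (left ` lpart X v) + card (right ` rpart X v)"
        by (intro card_Un_disjoint) auto
      then show ?thesis
        unfolding parts_union[OF that(3), of v, symmetric] by (simp add: card_image inj_on_def)
    qed
    show "f (card (X v)) = f (card (X' v))"
      unfolding card[OF *(1,3,5)] card[OF *(2,4,6)] by (rule add[OF eq])
  qed
  show "determines (\<lambda>G X. f (card (X v))) (\<lambda>G X. P (card (X v)))"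
    unfolding determines_def using P by blast
qed

text \<open>The new values are subsets of a finite set of old values. Each operation is treated by
  an exchange argument: a choice of \<open>Y\<close> on the result induces choices on the arguments,
  equal invariants supply choices with the same values on the other arguments, and these recombine
  to a choice on the other result.\<close>

lemma regular_ex:
  assumes "regular P"
  shows "regular (\<lambda>G X. \<exists>Y \<subseteq> elems G. P G (X(v := Y)))"
proof -
  obtain \<theta>0 :: "nat thgraph \<Rightarrow> ('a \<Rightarrow> nat set) \<Rightarrow> nat"
    where 0: "graph_congruence \<theta>0" "determines \<theta>0 P"
    using assms unfolding regular_def by blast
  let ?var = "\<lambda>G X. X v :: nat set"
  \<comment> \<open>The second component tells which \<open>Y\<close> avoid the vertex deleted by a fusion.\<close>
  define \<theta> where "\<theta> G X = (\<theta>0 G X, meet_info ?var ?var G X)" for G X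
  have "graph_congruence \<theta>"
    unfolding \<theta>_def
    by (intro graph_congruence_Pair 0 graph_congruence_meet_info equivariant_var)
  then interpret graph_congruence \<theta> .
  define \<Theta> where "\<Theta> G X = (\<lambda>Y. \<theta> G (X(v := Y))) ` Pow (elems G)" for G X
  have upd: "valued G (X(v := Y))" if "valued G X" "Y \<subseteq> elems G"
    for X Y and G :: "nat thgraph" using that by (simp add: valued_def)
  have "graph_congruence \<Theta>"
  proof
    fix n
    have "{\<Theta> G X | G X. graph n G \<and> valued G X} \<subseteq> Pow {\<theta> G X | G X. graph n G \<and> valued G X}"
      unfolding \<Theta>_def using upd by blast
    then show "finite {\<Theta> G X | G X. graph n G \<and> valued G X}"
      by (rule finite_subset) (simp add: finite_range)
  next
    fix n h and G H :: "nat thgraph" and X :: "'a \<Rightarrow> nat set"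
    assume *: "graph n G" "graph n H" "valued G X" "iso_map h G H"
    have "\<theta> H ((\<lambda>u. h ` X u)(v := h ` Y)) = \<theta> G (X(v := Y))" if "Y \<subseteq> elems G" for Y
    proof -
      have "(\<lambda>u. h ` X u)(v := h ` Y) = (\<lambda>u. h ` (X(v := Y)) u)"
        by (simp add: fun_eq_iff)
      then show ?thesis using iso[OF *(1,2) upd[OF *(3) that] *(4)] by simp
    qed
    moreover have "Pow (elems H) = image h ` Pow (elems G)"
      using image_Pow_surj[of h "elems G"] iso_map_elems[OF *(4)] by simp
    ultimately show "\<Theta> H (\<lambda>u. h ` X u) = \<Theta> G X"
      by (simp add: \<Theta>_def image_image)
  next
    fix n m and G G' H H' :: "nat thgraph" and X X' :: "'a \<Rightarrow> nat set"
    assume *: "graph n G" "graph n G'" "graph m H" "graph m H'"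
      "valued (raw_sum G H) X" "valued (raw_sum G' H') X'"
      "\<Theta> G (lpart X) = \<Theta> G' (lpart X')" "\<Theta> H (rpart X) = \<Theta> H' (rpart X')"
    have "\<Theta> (raw_sum G H) X \<subseteq> \<Theta> (raw_sum G' H') X'"
      if *: "graph n G" "graph n G'" "graph m H" "graph m H'"
      "valued (raw_sum G H) X" "valued (raw_sum G' H') X'"
      "\<Theta> G (lpart X) = \<Theta> G' (lpart X')" "\<Theta> H (rpart X) = \<Theta> H' (rpart X')"
    for G G' H H' :: "nat thgraph" and X X' :: "'a \<Rightarrow> nat set"
    proof
      fix t assume "t \<in> \<Theta> (raw_sum G H) X"
      then obtain Y where Y: "Y \<subseteq> elems (raw_sum G H)" "t = \<theta> (raw_sum G H) (X(v := Y))"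
        by (auto simp: \<Theta>_def)
      have "left -` Y \<subseteq> elems G" "right -` Y \<subseteq> elems H"
        using Y(1) by (auto simp: elems_raw_sum)
      then have "\<theta> G ((lpart X)(v := left -` Y)) \<in> \<Theta> G (lpart X)"
        "\<theta> H ((rpart X)(v := right -` Y)) \<in> \<Theta> H (rpart X)"
        by (simp_all add: \<Theta>_def)
      then have "\<theta> G ((lpart X)(v := left -` Y)) \<in> \<Theta> G' (lpart X')"
        "\<theta> H ((rpart X)(v := right -` Y)) \<in> \<Theta> H' (rpart X')"
        by (simp_all only: *(7,8))
      then obtain Y1 Y2 where Y12: "Y1 \<subseteq> elems G'" "Y2 \<subseteq> elems H'"
        "\<theta> G ((lpart X)(v := left -` Y)) = \<theta> G' ((lpart X')(v := Y1))"
        "\<theta> H ((rpart X)(v := right -` Y)) = \<theta> H' ((rpart X')(v := Y2))"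
        by (auto simp: \<Theta>_def)
      \<comment> \<open>The replacements found in the two summands are independent, so they can be
        joined into one set on the sum.\<close>
      let ?Y = "left ` Y1 \<union> right ` Y2"
      have sub: "?Y \<subseteq> elems (raw_sum G' H')" using Y12(1,2) by (auto simp: elems_raw_sum)
      have "t = \<theta> (raw_sum G' H') (X'(v := ?Y))"
        unfolding Y(2)
        by (rule sum[OF *(1-4) upd[OF *(5) Y(1)] upd[OF *(6) sub]])
          (simp_all only: parts_upd parts_of_union Y12(3,4))
      then show "t \<in> \<Theta> (raw_sum G' H') X'" using sub by (auto simp: \<Theta>_def)
    qed
    from this[OF *] this[OF *(2,1,4,3,6,5) *(7,8)[symmetric]]
    show "\<Theta> (raw_sum G H) X = \<Theta> (raw_sum G' H') X'" by (rule equalityI)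
  next
    fix n \<sigma> and G G' :: "nat thgraph" and X X' :: "'a \<Rightarrow> nat set"
    assume *: "graph n G" "graph n G'" "set \<sigma> \<subseteq> {..<n}" "valued G X" "valued G' X'" "\<Theta> G X = \<Theta> G' X'"
    have "\<Theta> (raw_redef \<sigma> G) X \<subseteq> \<Theta> (raw_redef \<sigma> G') X'"
      if *: "graph n G" "graph n G'" "valued G X" "valued G' X'" "\<Theta> G X = \<Theta> G' X'"
      for G G' :: "nat thgraph" and X X' :: "'a \<Rightarrow> nat set"
    proof
      fix t assume "t \<in> \<Theta> (raw_redef \<sigma> G) X"
      then obtain Y where Y: "Y \<subseteq> elems G" "t = \<theta> (raw_redef \<sigma> G) (X(v := Y))"
        by (auto simp: \<Theta>_def)
      then have "\<theta> G (X(v := Y)) \<in> \<Theta> G X" by (simp add: \<Theta>_def)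
      then have "\<theta> G (X(v := Y)) \<in> \<Theta> G' X'" unfolding *(5) .
      then obtain Y' where Y': "Y' \<subseteq> elems G'" "\<theta> G (X(v := Y)) = \<theta> G' (X'(v := Y'))"
        by (auto simp: \<Theta>_def)
      have "t = \<theta> (raw_redef \<sigma> G') (X'(v := Y'))"
        unfolding Y(2)
        by (rule redef[OF *(1,2) \<open>set \<sigma> \<subseteq> {..<n}\<close> upd[OF *(3) Y(1)] upd[OF *(4) Y'(1)] Y'(2)])
      then show "t \<in> \<Theta> (raw_redef \<sigma> G') X'" using Y'(1) by (auto simp: \<Theta>_def)
    qed
    from this[OF *(1,2,4-6)] this[OF *(2,1,5,4) *(6)[symmetric]]
    show "\<Theta> (raw_redef \<sigma> G) X = \<Theta> (raw_redef \<sigma> G') X'" by (rule equalityI)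
  next
    fix n a b and G G' :: "nat thgraph" and X X' :: "'a \<Rightarrow> nat set"
    assume *: "graph n G" "graph n G'" "a < n" "b < n" "valued (raw_fuse a b G) X"
      "valued (raw_fuse a b G') X'" "\<Theta> G X = \<Theta> G' X'"
    have "\<Theta> (raw_fuse a b G) X \<subseteq> \<Theta> (raw_fuse a b G') X'"
      if *: "graph n G" "graph n G'" "valued (raw_fuse a b G) X"
      "valued (raw_fuse a b G') X'" "\<Theta> G X = \<Theta> G' X'"
      for G G' :: "nat thgraph" and X X' :: "'a \<Rightarrow> nat set"
    proof
      note ab = \<open>a < n\<close> \<open>b < n\<close>
      fix t assume "t \<in> \<Theta> (raw_fuse a b G) X"
      then obtain Y where Y: "Y \<subseteq> elems (raw_fuse a b G)" "t = \<theta> (raw_fuse a b G) (X(v := Y))"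
        by (auto simp: \<Theta>_def)
      then have "Y \<subseteq> elems G" by (simp add: elems_raw_fuse[OF *(1) ab])
      then have "\<theta> G (X(v := Y)) \<in> \<Theta> G X" by (simp add: \<Theta>_def)
      then have "\<theta> G (X(v := Y)) \<in> \<Theta> G' X'" unfolding *(5) .
      then obtain Y' where Y': "Y' \<subseteq> elems G'" "\<theta> G (X(v := Y)) = \<theta> G' (X'(v := Y'))"
        by (auto simp: \<Theta>_def)
      \<comment> \<open>So far \<open>Y'\<close> is only a set of elements of \<open>G'\<close>. It
        must also avoid the vertex deleted by the fusion, unless the two terminals coincide; equal
        coincidences and traces carry this over from \<open>Y\<close>.\<close>
      then have "coincidences G = coincidences G'" "trace G Y = trace G' Y'"
        by (simp_all add: \<theta>_def meet_info_def)
      then have "(a, b) \<in> coincidences G \<longleftrightarrow> (a, b) \<in> coincidences G'" "b \<in> trace G Y \<longleftrightarrow> b \<in> trace G' Y'"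
        by simp_all
      then have sub: "Y' \<subseteq> elems (raw_fuse a b G')"
        using Y(1) Y'(1) *(1,2) ab
        by (simp add: elems_raw_fuse[OF *(1) ab] elems_raw_fuse[OF *(2) ab] coincidences_def
            trace_def graph_def)
      have "t = \<theta> (raw_fuse a b G') (X'(v := Y'))"
        unfolding Y(2)
        by (rule fuse[OF *(1,2) ab upd[OF *(3) Y(1)] upd[OF *(4) sub] Y'(2)])
      then show "t \<in> \<Theta> (raw_fuse a b G') X'" using sub by (auto simp: \<Theta>_def)
    qed
    from this[OF *(1,2,5-7)] this[OF *(2,1,6,5) *(7)[symmetric]]
    show "\<Theta> (raw_fuse a b G) X = \<Theta> (raw_fuse a b G') X'" by (rule equalityI)
  qed
  moreover have "determines \<Theta> (\<lambda>G X. \<exists>Y \<subseteq> elems G. P G (X(v := Y)))"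
  proof -
    have "\<exists>Y' \<subseteq> elems G'. P G' (X'(v := Y'))"
      if *: "graph n G" "graph n G'" "valued G X" "valued G' X'" "\<Theta> G X = \<Theta> G' X'"
        and Y: "Y \<subseteq> elems G" "P G (X(v := Y))" for n G G' X X' Y
    proof -
      have "\<theta> G (X(v := Y)) \<in> \<Theta> G X" using Y(1) by (simp add: \<Theta>_def)
      then have "\<theta> G (X(v := Y)) \<in> \<Theta> G' X'" unfolding *(5) .
      then obtain Y' where Y': "Y' \<subseteq> elems G'" "\<theta> G (X(v := Y)) = \<theta> G' (X'(v := Y'))"
        by (auto simp: \<Theta>_def)
      then have "P G (X(v := Y)) = P G' (X'(v := Y'))"
        by (intro determinesD[OF 0(2) *(1,2) upd[OF *(3) Y(1)] upd[OF *(4) Y'(1)]])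
          (simp add: \<theta>_def)
      then show ?thesis using Y'(1) Y(2) by blast
    qed
    then show ?thesis unfolding determines_def by metis
  qed
  ultimately show ?thesis by (rule regularI)
qed

section \<open>Truth of formulas is regular\<close>

lemma regular_imp: "regular P \<Longrightarrow> regular Q \<Longrightarrow> regular (\<lambda>G X. P G X \<longrightarrow> Q G X)"
  using regular_not[OF regular_and[OF _ regular_not, of P Q]] by simp

lemma regular_all:
  assumes "regular P"
  shows "regular (\<lambda>G X. \<forall>Y \<subseteq> elems G. P G (X(v := Y)))"
  using regular_not[OF regular_ex[OF regular_not[OF assms], of v]] by simp

lemma regular_all_less:
  fixes k :: nat
  shows "(\<And>l. regular (P l)) \<Longrightarrow> regular (\<lambda>G X. \<forall>l < k. P l G X)"
proof (induction k)
  case 0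
  show ?case using regular_const[of True] by simp
next
  case (Suc k)
  then show ?case
    using regular_and[OF Suc.IH[OF Suc.prems] Suc.prems[of k]]
    by (simp add: All_less_Suc conj_commute)
qed

text \<open>Truncation at 2 is the least one that separates 1 from larger numbers, and truncated
  sums depend only on truncated summands.\<close>

lemma regular_card_eq_1: "regular (\<lambda>G X. card (X v) = 1)"
proof (rule regular_card[of "min 2"])
  show "finite (range (min (2 :: nat)))" by (rule finite_subset[of _ "{..2}"]) auto
qed (auto simp: min_def split: if_splits)

lemma regular_card_mod:
  assumes "0 < p"
  shows "regular (\<lambda>G X. card (X v) mod p = r mod p)"
proof (rule regular_card[of "\<lambda>x. x mod p" "\<lambda>x. x mod p = r mod p"])
  have "range (\<lambda>x. x mod p) \<subseteq> {..<p}" by (rule image_subsetI) (simp add: assms)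
  then show "finite (range (\<lambda>x. x mod p))" by (rule finite_subset) simp
  show "(x + y) mod p = (x' + y') mod p" if "x mod p = x' mod p" "y mod p = y' mod p"
    for x x' y y' using that by (rule mod_add_cong)
  show "x mod p = r mod p \<longleftrightarrow> y mod p = r mod p" if "x mod p = y mod p" for x y
    by (simp only: that)
qed

text \<open>Individual variables occupy the left half of the variables and denote singletons here. In an
  assignment restricted to a summand they may also denote the empty set. The clause for \<open>FConn\<close>
  treats the end points one at a time, which is correct because \<open>X (Inl y)\<close> is a singleton.\<close>

primrec isat :: "'a thgraph \<Rightarrow> (nat + nat \<Rightarrow> 'a set) \<Rightarrow> cmso \<Rightarrow> bool" where
  "isat G X (FVert x) \<longleftrightarrow> X (Inl x) \<inter> verts G \<noteq> {}"
| "isat G X (FEdge x) \<longleftrightarrow> X (Inl x) \<inter> edges G \<noteq> {}"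
| "isat G X (FEq x y) \<longleftrightarrow> X (Inl x) \<inter> X (Inl y) \<noteq> {}"
| "isat G X (FMem Y x) \<longleftrightarrow> X (Inl x) \<inter> X (Inr Y) \<noteq> {}"
| "isat G X (FConn y xs) \<longleftrightarrow>
     X (Inl y) \<inter> {e \<in> edges G. length (ends G e) = length xs} \<noteq> {} \<and>
     (\<forall>l < length xs. attached (Inl y) l G X \<inter> X (Inl (xs ! l)) \<noteq> {})"
| "isat G X (FCard p r Y) \<longleftrightarrow> card (X (Inr Y)) mod p = r mod p"
| "isat G X (FNeg \<phi>) \<longleftrightarrow> \<not> isat G X \<phi>"
| "isat G X (FAnd \<phi> \<psi>) \<longleftrightarrow> isat G X \<phi> \<and> isat G X \<psi>"
| "isat G X (FAllI x \<phi>) \<longleftrightarrow>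
     (\<forall>Y \<subseteq> elems G. card Y = 1 \<longrightarrow> isat G (X(Inl x := Y)) \<phi>)"
| "isat G X (FAllS Z \<phi>) \<longleftrightarrow>
     (\<forall>Y \<subseteq> elems G. Y \<inter> verts G = {} \<or> Y \<inter> edges G = {} \<longrightarrow> isat G (X(Inr Z := Y)) \<phi>)"

text \<open>Being a singleton and being unmixed are regular themselves, so the restricted
  quantifiers are unrestricted ones over an implication.\<close>

lemma regular_isat: "is_formula \<phi> \<Longrightarrow> regular (\<lambda>G X. isat G X \<phi>)"
proof (induction \<phi>)
  case (FVert x)
  show ?case using regular_meets[OF equivariant_var equivariant_verts] by simp
next
  case (FEdge x)
  show ?case using regular_meets[OF equivariant_var equivariant_edges] by simp
next
  case (FEq x y)
  show ?case using regular_meets[OF equivariant_var equivariant_var] by simp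
next
  case (FMem Y x)
  show ?case using regular_meets[OF equivariant_var equivariant_var] by simp
next
  case (FConn y xs)
  show ?case
    unfolding isat.simps
    by (intro regular_and regular_all_less regular_meets equivariant_var equivariant_edges_length
        equivariant_attached)
next
  case (FCard p r Y)
  then show ?case by (simp add: regular_card_mod)
next
  case (FNeg \<phi>)
  then show ?case by (simp add: regular_not)
next
  case (FAnd \<phi> \<psi>)
  then show ?case by (simp add: regular_and)
next
  case (FAllI x \<phi>)
  then have "regular (\<lambda>G X. card (X (Inl x)) = 1 \<longrightarrow> isat G X \<phi>)"
    by (intro regular_imp regular_card_eq_1) simp
  from regular_all[OF this, of "Inl x"] show ?case by simp
next
  case (FAllS Z \<phi>)
  then have "regular (\<lambda>G X. \<not> (X (Inr Z) \<inter> verts G \<noteq> {} \<and> X (Inr Z) \<inter> edges G \<noteq> {}) \<longrightarrow> isat G X \<phi>)"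
    by (intro regular_imp regular_not regular_and regular_meets equivariant_var equivariant_verts
        equivariant_edges) simp
  from regular_all[OF this, of "Inr Z"] show ?case by simp
qed

section \<open>Comparison with the original semantics\<close>

lemma isat_cong:
  "(\<And>x. x \<in> free_ind \<phi> \<Longrightarrow> X (Inl x) = X' (Inl x)) \<Longrightarrow>
    (\<And>Y. Y \<in> free_set \<phi> \<Longrightarrow> X (Inr Y) = X' (Inr Y)) \<Longrightarrow> isat G X \<phi> \<longleftrightarrow> isat G X' \<phi>"
proof (induction \<phi> arbitrary: X X')
  case (FAllI x \<phi>)
  have "isat G (X(Inl x := Y)) \<phi> \<longleftrightarrow> isat G (X'(Inl x := Y)) \<phi>" for Y
    by (rule FAllI.IH) (use FAllI.prems in auto)
  then show ?case by simp
next
  case (FAllS Z \<phi>)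
  have "isat G (X(Inr Z := Y)) \<phi> \<longleftrightarrow> isat G (X'(Inr Z := Y)) \<phi>" for Y
    by (rule FAllS.IH) (use FAllS.prems in auto)
  then show ?case by simp
next
  case (FAnd \<phi> \<psi>)
  have "isat G X \<phi> = isat G X' \<phi>" by (rule FAnd.IH) (use FAnd.prems in auto)
  moreover have "isat G X \<psi> = isat G X' \<psi>" by (rule FAnd.IH) (use FAnd.prems in auto)
  ultimately show ?case by simp
next
  case (FNeg \<phi>)
  have "isat G X \<phi> = isat G X' \<phi>" by (rule FNeg.IH) (use FNeg.prems in auto)
  then show ?case by simp
qed (simp_all add: attached_def)

definition assign :: "(nat \<Rightarrow> 'a) \<Rightarrow> (nat \<Rightarrow> 'a set) \<Rightarrow> nat + nat \<Rightarrow> 'a set" where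
  "assign i s = case_sum (\<lambda>x. {i x}) s"

lemma assign_upd:
  "assign (i(x := a)) s = (assign i s)(Inl x := {a})"
  "assign i (s(Z := Y)) = (assign i s)(Inr Z := Y)"
  by (auto simp: assign_def fun_eq_iff split: sum.split)

text \<open>The equivalence relies on assignments of the form \<open>assign i s\<close>, whose
  individual variables denote singletons; both quantifiers preserve this form.\<close>

lemma sat_iff_isat:
  assumes G: "is_thgraph G"
  shows "sat G i s \<phi> \<longleftrightarrow> isat G (assign i s) \<phi>"
proof (induction \<phi> arbitrary: i s)
  case (FConn y xs)
  have "ends G (i y) = map i xs \<longleftrightarrow>
      length (ends G (i y)) = length xs \<and> (\<forall>l < length xs. ends G (i y) ! l = i (xs ! l))"
    by (auto simp: list_eq_iff_nth_eq)
  \<comment> \<open>A single edge contributes at most one \<open>l\<close>-th end point, so meeting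
    the singleton of a variable means equality with its value.\<close>
  moreover have "attached (Inl y) l G (assign i s) =
      (if i y \<in> edges G \<and> l < length (ends G (i y)) then {ends G (i y) ! l} else {})" for l
    by (auto simp: attached_def assign_def)
  ultimately show ?case by (auto simp: assign_def)
next
  case (FAllI x \<phi>)
  have "(\<forall>Y \<subseteq> elems G. card Y = 1 \<longrightarrow> Q Y) \<longleftrightarrow> (\<forall>a \<in> elems G. Q {a})" for Q
    by (auto simp: card_1_singleton_iff)
  then show ?case by (simp only: sat.simps isat.simps FAllI.IH assign_upd elems_def)
next
  case (FAllS Z \<phi>)
  \<comment> \<open>Disjointness of vertices and edges makes the two descriptions of unmixed sets
    agree.\<close>
  have "Y \<subseteq> elems G \<and> (Y \<inter> verts G = {} \<or> Y \<inter> edges G = {}) \<longleftrightarrow> Y \<in> Pow (verts G) \<union> Pow (edges G)"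
    for Y using G by (auto simp: elems_def is_thgraph_def is_hgraph_def)
  then have "(\<forall>Y \<subseteq> elems G. Y \<inter> verts G = {} \<or> Y \<inter> edges G = {} \<longrightarrow> Q Y) \<longleftrightarrow>
      (\<forall>Y \<in> Pow (verts G) \<union> Pow (edges G). Q Y)" for Q by metis
  then show ?case by (simp only: sat.simps isat.simps FAllS.IH assign_upd)
qed (auto simp: assign_def)

text \<open>A sentence has the same truth value under every assignment, also under the empty one,
  which is not of the form \<open>assign i s\<close>.\<close>

lemma hmodels_iff_isat:
  assumes G: "is_thgraph G" and \<phi>: "sentence \<phi>"
  shows "hmodels G \<phi> \<longleftrightarrow> isat G (\<lambda>_. {}) \<phi>"
proof -
  \<comment> \<open>A vertex yields an assignment into the graph, so the quantification in
    \<open>hmodels\<close> is not vacuous.\<close>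
  obtain v where v: "v \<in> verts G" using G by (auto simp: is_thgraph_def is_hgraph_def)
  have "sat G i s \<phi> \<longleftrightarrow> isat G (\<lambda>_. {}) \<phi>" for i s
    unfolding sat_iff_isat[OF G] by (rule isat_cong) (use \<phi> in \<open>simp_all add: sentence_def\<close>)
  moreover have "range (\<lambda>_. v) \<subseteq> verts G \<union> edges G" "range (\<lambda>_. {}) \<subseteq> Pow (verts G) \<union> Pow (edges G)"
    using v by auto
  ultimately show ?thesis unfolding hmodels_def by blast
qed

section \<open>Passage to isomorphism classes\<close>

lemma giso_iso_map:
  assumes "giso G H"
  shows "\<exists>h. iso_map h G H"
  using assms
proof (rule gisoE)
  fix f g
  assume 1: "is_thgraph G" "is_thgraph H"
    "bij_betw f (verts G) (verts H)" "bij_betw g (edges G) (edges H)"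
    "\<And>e. e \<in> edges G \<Longrightarrow> ends H (g e) = map f (ends G e)" "terms H = map f (terms G)"
  \<comment> \<open>The two bijections merge because vertices and edges of \<open>G\<close> are
    disjoint; disjointness in \<open>H\<close> gives joint injectivity.\<close>
  define h where "h x = (if x \<in> verts G then f x else g x)" for x
  have disj: "verts G \<inter> edges G = {}" "verts H \<inter> edges H = {}"
    using 1(1,2) by (auto simp: is_thgraph_def is_hgraph_def)
  have hv: "h x = f x" if "x \<in> verts G" for x using that by (simp add: h_def)
  have he: "h e = g e" if "e \<in> edges G" for e using that disj by (auto simp: h_def)
  have map: "map h xs = map f xs" if "set xs \<subseteq> verts G" for xs
    using that hv by (auto simp: subset_iff)
  have "ends H (h e) = map h (ends G e)" if "e \<in> edges G" for e
  proof -
    have "set (ends G e) \<subseteq> verts G" using 1(1) that by (simp add: is_thgraph_def is_hgraph_def)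
    from map[OF this] show ?thesis using 1(5)[OF that] he[OF that] by simp
  qed
  moreover have "terms H = map h (terms G)"
    using 1(1,6) map[of "terms G"] by (simp only: is_thgraph_def)
  moreover have "bij_betw h (verts G) (verts H)" "bij_betw h (edges G) (edges H)"
    using 1(3,4) bij_betw_cong[of "verts G" h f] bij_betw_cong[of "edges G" h g] hv he by blast+
  moreover from bij_betw_combine[OF this disj(2)] have "inj_on h (elems G)"
    by (simp add: elems_def bij_betw_def)
  ultimately have "iso_map h G H" unfolding iso_map_def bij_betw_def by blast
  then show "\<exists>h. iso_map h G H" by blast
qed

lemma tgraph_cases:
  obtains G where "g = abs_tgraph G" "is_thgraph G"
  using Quotient_abs_rep[OF Quotient_tgraph, of g] Quotient_rep_reflp[OF Quotient_tgraph, of g]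
  by (metis giso_def)

text \<open>Without free variables one fixed assignment suffices, so the congruence becomes an
  invariant of graphs alone; its invariance under isomorphism lets it descend to classes.\<close>

lemma sentence_invariant:
  assumes \<phi>: "sentence \<phi>"
  obtains k :: "tgraph \<Rightarrow> nat"
  where "compatible graph_alg k" "\<And>n. finite (k ` carr graph_alg n)"
    "\<And>g h n. g \<in> carr graph_alg n \<Longrightarrow> h \<in> carr graph_alg n \<Longrightarrow> k g = k h \<Longrightarrow>
      models g \<phi> \<longleftrightarrow> models h \<phi>"
proof -
  have "regular (\<lambda>G X. isat G X \<phi>)" using \<phi> regular_isat by (simp add: sentence_def)
  then obtain \<theta> :: "nat thgraph \<Rightarrow> (nat + nat \<Rightarrow> nat set) \<Rightarrow> nat"
    where \<theta>: "graph_congruence \<theta>" and det: "determines \<theta> (\<lambda>G X. isat G X \<phi>)"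
    unfolding regular_def by blast
  interpret graph_congruence \<theta> by fact
  \<comment> \<open>The empty assignment is admissible on every graph and stable under restriction
    to summands and under images, so it can accompany all operations and changes of
    representative.\<close>
  define none :: "nat + nat \<Rightarrow> nat set" where "none = (\<lambda>_. {})"
  have none: "valued G none" for G :: "nat thgraph" by (simp add: none_def valued_def)
  have parts: "lpart none = none" "rpart none = none"
    by (simp_all add: none_def lpart_def rpart_def fun_eq_iff)
  \<comment> \<open>The representative is arbitrary; the next step shows that any other gives the
    same value.\<close>
  define k where "k g = \<theta> (rep_tgraph g) none" for g
  have k: "k (abs_tgraph G) = \<theta> G none" if "is_thgraph G" for G
  proof -
    have iso': "giso (rep_tgraph (abs_tgraph G)) G"
      using Quotient_rep_abs[OF Quotient_tgraph giso_refl[OF that]] .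
    then obtain h where "iso_map h (rep_tgraph (abs_tgraph G)) G" using giso_iso_map by blast
    moreover have "graph (length (terms G)) (rep_tgraph (abs_tgraph G))" "graph (length (terms G)) G"
      using iso' by (auto simp: graph_def elim: gisoE)
    ultimately have "\<theta> G (\<lambda>v. h ` none v) = \<theta> (rep_tgraph (abs_tgraph G)) none"
      using iso none by blast
    then show ?thesis by (simp add: k_def none_def)
  qed
  have gtype: "gtype (abs_tgraph G) = length (terms G)" if "is_thgraph G" for G
    using gtype.abs_eq[OF giso_refl[OF that]] .
  have repr: "\<exists>G. g = abs_tgraph G \<and> graph n G" if "g \<in> carr graph_alg n" for g n
    using that gtype by (cases g rule: tgraph_cases) (auto simp: graph_alg_def graph_def)
  have k_graph: "k (abs_tgraph G) = \<theta> G none" if "graph n G" for n G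
    using that k by (simp add: graph_def)
  have sum_eq: "gsum (abs_tgraph G) (abs_tgraph H) = abs_tgraph (raw_sum G H)"
    if "graph n G" "graph m H" for n m G H
    using that gsum.abs_eq giso_refl by (simp add: graph_def)
  have redef_eq: "gredef \<sigma> (abs_tgraph G) = abs_tgraph (raw_redef \<sigma> G)"
    and fuse_eq: "gfuse a b (abs_tgraph G) = abs_tgraph (raw_fuse a b G)"
    if "graph n G" for n G \<sigma> a b
    using that gredef.abs_eq gfuse.abs_eq giso_refl by (simp_all add: graph_def)
  have ksum: "k (gsum g h) = k (gsum g' h')"
    if "g \<in> carr graph_alg n" "g' \<in> carr graph_alg n" "h \<in> carr graph_alg m" "h' \<in> carr graph_alg m"
      "k g = k g'" "k h = k h'" for g g' h h' n m
  proof -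
    from that(1-4) obtain G G' H H' where *: "g = abs_tgraph G" "graph n G" "g' = abs_tgraph G'" "graph n G'"
      "h = abs_tgraph H" "graph m H" "h' = abs_tgraph H'" "graph m H'"
      using repr by meson
    have "\<theta> (raw_sum G H) none = \<theta> (raw_sum G' H') none"
      by (rule sum[OF *(2,4,6,8)]) (use that(5,6) * k_graph none parts in auto)
    then show ?thesis
      using * k_graph graph_raw_sum by (metis sum_eq)
  qed
  have kredef: "k (gredef \<sigma> g) = k (gredef \<sigma> g')"
    if "g \<in> carr graph_alg n" "g' \<in> carr graph_alg n" "set \<sigma> \<subseteq> {..<n}" "k g = k g'" for g g' n \<sigma>
  proof -
    from that(1,2) obtain G G' where *: "g = abs_tgraph G" "graph n G" "g' = abs_tgraph G'" "graph n G'"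
      using repr by meson
    have "\<theta> (raw_redef \<sigma> G) none = \<theta> (raw_redef \<sigma> G') none"
      by (rule redef[OF *(2,4) that(3) none none]) (use that(4) * k_graph in auto)
    then show ?thesis
      using * that(3) k_graph graph_raw_redef by (metis redef_eq)
  qed
  have kfuse: "k (gfuse a b g) = k (gfuse a b g')"
    if "g \<in> carr graph_alg n" "g' \<in> carr graph_alg n" "a < n" "b < n" "k g = k g'" for g g' n a b
  proof -
    from that(1,2) obtain G G' where *: "g = abs_tgraph G" "graph n G" "g' = abs_tgraph G'" "graph n G'"
      using repr by meson
    have "\<theta> (raw_fuse a b G) none = \<theta> (raw_fuse a b G') none"
      by (rule fuse[OF *(2,4) that(3,4) none none]) (use that(5) * k_graph in auto)
    then show ?thesis
      using * that(3,4) k_graph graph_raw_fuse by (metis fuse_eq)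
  qed
  have args2: "xs \<in> args A [s, t] \<longleftrightarrow> (\<exists>x y. xs = [x, y] \<and> x \<in> carr A s \<and> y \<in> carr A t)"
    and args1: "xs \<in> args A [s] \<longleftrightarrow> (\<exists>x. xs = [x] \<and> x \<in> carr A s)"
    and args0: "xs \<in> args A [] \<longleftrightarrow> xs = []"
    for xs and A :: "(nat, gsym, tgraph) algebra" and s t
    by (auto simp: args_def list_all2_Cons2)
  show ?thesis
  proof (rule that[of k])
    have alg: "sig graph_alg = graph_sig" "oper graph_alg = gsym_op" "inT graph_sig = gsym_in"
      by (simp_all add: graph_alg_def graph_sig_def)
    show "compatible graph_alg k"
      unfolding compatible_def alg
    proof (intro ballI impI)
      fix f xs ys
      assume "f \<in> syms graph_sig" "xs \<in> args graph_alg (gsym_in f)"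
        "ys \<in> args graph_alg (gsym_in f)" "map k xs = map k ys"
      \<comment> \<open>For the constants both argument lists are empty, which is why
        \<open>graph_congruence\<close> has no clause for them.\<close>
      then show "k (gsym_op f xs) = k (gsym_op f ys)"
        by (cases f) (auto simp: graph_sig_def args0 args1 args2 intro: ksum kredef kfuse)
    qed
    show "finite (k ` carr graph_alg n)" for n
    proof (rule finite_subset[OF _ finite_range[of n]], rule image_subsetI)
      fix g assume "g \<in> carr graph_alg n"
      then show "k g \<in> {\<theta> G X | G X. graph n G \<and> valued G X}"
        using repr k_graph none by blast
    qed
    show "models g \<phi> \<longleftrightarrow> models h \<phi>"
      if gh: "g \<in> carr graph_alg n" "h \<in> carr graph_alg n" "k g = k h" for g h n
    proof -
      obtain G H where *: "g = abs_tgraph G" "graph n G" "h = abs_tgraph H" "graph n H"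
        using gh(1,2) repr by meson
      have mod: "models (abs_tgraph K) \<phi> \<longleftrightarrow> isat K none \<phi>" if "graph n K" for K
        using models.abs_eq[OF giso_refl, of K] hmodels_iff_isat[OF _ \<phi>, of K] that
        by (simp add: graph_def none_def)
      have "isat G none \<phi> \<longleftrightarrow> isat H none \<phi>"
        by (rule determinesD[OF det *(2,4) none none]) (use gh(3) * k_graph in auto)
      then show ?thesis using * mod by simp
    qed
  qed
qed

theorem theoremA5p2:
  fixes A :: "(nat, (nat, gsym, tgraph) clsym flsym, tgraph) algebra"
    and \<phi> :: cmso
    and n :: nat
  assumes "inherited A graph_alg"
    and "sentence \<phi>"
  shows "recognisable A n {G \<in> carr A n. models G \<phi>}"
proof -
  obtain k :: "tgraph \<Rightarrow> nat"
    where k: "compatible graph_alg k" "\<And>n. finite (k ` carr graph_alg n)"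
    "\<And>g h n. g \<in> carr graph_alg n \<Longrightarrow> h \<in> carr graph_alg n \<Longrightarrow> k g = k h \<Longrightarrow>
      models g \<phi> \<longleftrightarrow> models h \<phi>"
    using sentence_invariant[OF assms(2)] by blast
  have "n \<in> sorts (sig graph_alg)" by (simp add: graph_alg_def graph_sig_def)
  then show ?thesis
    by (rule inherited_recognisable[OF is_algebra_graph_alg assms(1) _ k(1,2),
          where P = "\<lambda>G. models G \<phi>"]) (use k(3) in blast)
qed

end
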